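(* Let $n\ge 2$. The quantum transport matrices $M_1$ and $M_2$ of the $SL_n$-quiver satisfy $$R_n^{T}(q)\,\overset{1}{M_i}\otimes\overset{2}{M_i}=\overset{2}{M_i}\otimes\overset{1}{M_i}\,R_n(q),\qquad i=1,2,$$ $$\overset{1}{M_1}\otimes\overset{2}{M_2}=\overset{2}{M_2}\otimes\overset{1}{M_1}\,R_n(q),$$ where $$R_n(q)=q^{-1/n}\Big[\sum_{i,j}\overset{1}{e}_{ii}\otimes\overset{2}{e}_{jj}+(q-1)\sum_i\overset{1}{e}_{ii}\otimes\overset{2}{e}_{ii}+(q-q^{-1})\sum_{i>j}\overset{1}{e}_{ij}\otimes\overset{2}{e}_{ji}\Big]$$ is the quantum trigonometric $R$-matrix and $R_n^T$ is its total transpose.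
   Context: Faces and skew form. Let $I=\{(a,b,c)\in\mathbb Z_{\ge0}^3: a+b+c=n\}$, drawn as a triangular lattice with $(n,0,0)$ at the bottom left, $(0,n,0)$ at the bottom right, $(0,0,n)$ at the top. For each $(a,b,c)\in\mathbb Z_{\ge 0}^3$ with $a+b+c=n-1$ (a white triangle) take the three half-arrows $(a+1,b,c)\to(a,b,c+1)\to(a,b+1,c)\to(a+1,b,c)$; for each $(a,b,c)\in\mathbb Z_{\ge0}^3$ with $a+b+c=n-2$ (a black triangle) take the three half-arrows $(a+1,b,c+1)\to(a+1,b+1,c)\to(a,b+1,c+1)\to(a+1,b,c+1)$. Define the skew-symmetric bilinear form on $\mathbb Q^I$ (basis identified with $I$) by $\langle\alpha,\beta\rangle=\frac12(\#\{\alpha\to\beta\}-\#\{\beta\to\alpha\})$, counting half-arrows. Quantum torus. The quantum torus has basis $Z_\lambda$, $\lambda\in\mathbb Q^I$, over a field containing all rational powers of the formal variable $q$, with product $Z_\lambda Z_\mu=q^{\langle\lambda,\mu\rangle}Z_{\lambda+\mu}$. Thus $Z_\beta Z_\alpha=q^{-2\langle\alpha,\beta\rangle}Z_\alpha Z_\beta$; for example $Z_{n,0,0}Z_{n-1,0,1}=q\,Z_{n-1,0,1}Z_{n,0,0}$. For a monomial, its Weyl (normally ordered) form $:\prod_\alpha Z_\alpha^{r_\alpha}:$ is $Z_{\sum r_\alpha\alpha}$. Network. The dual directed planar graph has white vertices $w_{abc}$ ($a+b+c=n-1$) and black vertices $b_{abc}$ ($a+b+c=n-2$) located at the centers of the corresponding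 triangles. Edges: $w_{abc}\to b_{a,b-1,c}$ (if $b\ge1$), $w_{abc}\to b_{a,b,c-1}$ (if $c\ge 1$), $b_{abc}\to w_{a+1,b,c}$; source $i$ (right side, $1\le i\le n$) $\to w_{0,i-1,n-i}$; $w_{i-1,0,n-i}\to$ left sink $i'$; $w_{n-i,i-1,0}\to$ bottom sink $i''$. Faces of the graph are labelled by $I$. The weight of a directed path $P$ from a source to a sink is $w(P)=\,:\prod_\alpha Z_\alpha:$, the product over all faces $\alpha$ lying to the right of $P$ (for paths to left sinks these are the faces above the path; for paths to bottom sinks, the faces on the side containing $(n,0,0)$ and $(0,0,n)$). Define $n\times n$ matrices $(\mathcal M_1)_{ij}=\sum_{P:j\leadsto i'}w(P)$, $(\mathcal M_2)_{ij}=\sum_{P:j\leadsto i''}w(P)$. Normalization. $D_1=\,:\prod_{(a,b,c)\in I}Z_{a,b,c}^{c/n}:$, $D_2=\,:\prod_{(a,b,c)\in I}Z_{a,b,c}^{a/n}:$, $Q=\mathrm{diag}(q^{1/2-j})_{j=1}^n$, $S_{ij}=(-1)^{n-i}\delta_{i,n+1-j}$. The quantum transport matrices are $M_1=QS\mathcal M_1D_1^{-1}$, $M_2=QS\mathcal M_2D_1^{-1}D_2^{-1}$. Tensor notation. $\overset1M$, $\overset2M$ act in the first and second tensor factor of $\mathbb C^n\otimes\mathbb C^n$: $(\overset1M\otimes\overset2N)_{(ik),(jl)}=M_{ij}N_{kl}$ and $(\overset2N\otimes\overset1M)_{(ik),(jl)}=N_{kl}M_{ij}$ (the order of the noncommuting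 entries follows the written order). $e_{ij}$ are matrix units.
   Formalization: The quantum torus product is taken as Z_λ Z_μ = q^{-⟨λ,μ⟩} Z_{λ+μ}, with the sign of the exponent reversed, because with the printed sign q^{+⟨λ,μ⟩} the relations with R_n(q) already fail for n = 2. *)

theory Defs
  imports "HOL-Library.Poly_Mapping" "HOL-Computational_Algebra.Polynomial"
    "Graph_Theory.Arc_Walk"
begin

section \<open>Faces and the skew form\<close>

type_synonym face = "nat \<times> nat \<times> nat"

definition faces :: "nat \<Rightarrow> face set" where
  "faces n = {(a, b, c). a + b + c = n}"

fun white_half_arrows :: "face \<Rightarrow> (face \<times> face) set" where
  "white_half_arrows (a, b, c) =
     {((a+1, b, c), (a, b, c+1)), ((a, b, c+1), (a, b+1, c)), ((a, b+1, c), (a+1, b, c))}"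

fun black_half_arrows :: "face \<Rightarrow> (face \<times> face) set" where
  "black_half_arrows (a, b, c) =
     {((a+1, b, c+1), (a+1, b+1, c)), ((a+1, b+1, c), (a, b+1, c+1)), ((a, b+1, c+1), (a+1, b, c+1))}"

text \<open>Half-arrows are counted with multiplicity: an interior side of the triangulation carries one
  half-arrow from each of the two triangles that share it.\<close>

definition num_half_arrows :: "nat \<Rightarrow> face \<Rightarrow> face \<Rightarrow> nat" where
  "num_half_arrows n \<alpha> \<beta> =
     card {(a, b, c). a + b + c + 1 = n \<and> (\<alpha>, \<beta>) \<in> white_half_arrows (a, b, c)}
   + card {(a, b, c). a + b + c + 2 = n \<and> (\<alpha>, \<beta>) \<in> black_half_arrows (a, b, c)}"

definition face_form :: "nat \<Rightarrow> face \<Rightarrow> face \<Rightarrow> rat" where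
  "face_form n \<alpha> \<beta> = (of_nat (num_half_arrows n \<alpha> \<beta>) - of_nat (num_half_arrows n \<beta> \<alpha>)) / 2"

text \<open>\<open>\<rat>\<^sup>I\<close> is the subspace of vectors supported on \<^term>\<open>faces n\<close>.  All exponents built below lie in
  it; using one ambient type for all \<open>n\<close> avoids a dependent type.\<close>

type_synonym qvec = "face \<Rightarrow>\<^sub>0 rat"

definition skew_form :: "nat \<Rightarrow> qvec \<Rightarrow> qvec \<Rightarrow> rat" where
  "skew_form n \<kappa> \<mu> =
     (\<Sum>\<alpha>\<in>faces n. \<Sum>\<beta>\<in>faces n. Poly_Mapping.lookup \<kappa> \<alpha> * Poly_Mapping.lookup \<mu> \<beta> * face_form n \<alpha> \<beta>)"

section \<open>The quantum torus\<close>

text \<open>\<open>qp r\<close> plays the role of \<open>q\<^sup>r\<close> in the ground field.  The last clause says that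
  \<open>q = qp 1\<close> is transcendental over the prime field, i.e. a formal variable.\<close>

definition formal_rational_powers :: "(rat \<Rightarrow> 'k::field) \<Rightarrow> bool" where
  "formal_rational_powers qp \<longleftrightarrow>
     qp 0 = 1 \<and> (\<forall>r s. qp (r + s) = qp r * qp s) \<and>
     (\<forall>p :: int poly. map_poly of_int p \<noteq> (0 :: 'k poly) \<longrightarrow> poly (map_poly of_int p) (qp 1) \<noteq> 0)"

type_synonym 'k qtorus = "qvec \<Rightarrow>\<^sub>0 'k"

definition Zmon :: "qvec \<Rightarrow> ('k::field) qtorus" where
  "Zmon \<kappa> = Poly_Mapping.single \<kappa> 1"

text \<open>The product is the bilinear extension of \<open>Z\<^sub>\<kappa> Z\<^sub>\<mu> = q\<^bsup>-\<langle>\<kappa>,\<mu>\<rangle>\<^esup> Z\<^sub>\<kappa>\<^sub>+\<^sub>\<mu>\<close>; the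
  multiplication \<open>*\<close> of the type is the untwisted one and is not used.

  The source prints the exponent as \<open>+\<langle>\<kappa>,\<mu>\<rangle>\<close>, which is incompatible with its \<open>R\<close>-matrix
  relations, where \<open>R\<close> depends on the same \<open>q\<close>.  For \<open>n = 2\<close> the relation between \<open>M\<^sub>1\<close> and
  \<open>M\<^sub>2\<close> requires \<open>(M\<^sub>1)\<^sub>1\<^sub>1 (M\<^sub>2)\<^sub>1\<^sub>2 = q\<^bsup>-1/2\<^esup> (M\<^sub>2)\<^sub>1\<^sub>2 (M\<^sub>1)\<^sub>1\<^sub>1\<close>; these two entries are multiples
  of \<open>Z\<^sub>\<kappa>\<close> and \<open>Z\<^sub>\<mu>\<close> with \<open>\<kappa> = ((1,0,1) - (0,1,1))/2\<close>, \<open>\<mu> = ((0,1,1) + (1,1,0))/2\<close> (a face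
  standing for its basis vector), and \<open>\<langle>\<kappa>,\<mu>\<rangle> = 1/4\<close>, so the printed sign gives \<open>q\<^bsup>1/2\<^esup>\<close>
  instead.  The sign is therefore reversed here, i.e. \<open>q\<close> is replaced by its inverse in the
  commutation rule; the form, the weights, the normalization and \<open>R\<close> are as in the source.\<close>

definition qt_mult :: "nat \<Rightarrow> (rat \<Rightarrow> 'k::field) \<Rightarrow> 'k qtorus \<Rightarrow> 'k qtorus \<Rightarrow> 'k qtorus" where
  "qt_mult n qp f g =
     (\<Sum>\<kappa>\<in>Poly_Mapping.keys f. \<Sum>\<mu>\<in>Poly_Mapping.keys g.
        Poly_Mapping.single (\<kappa> + \<mu>)
          (qp (- skew_form n \<kappa> \<mu>) * (Poly_Mapping.lookup f \<kappa> * Poly_Mapping.lookup g \<mu>)))"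

definition qt_scale :: "'k::field \<Rightarrow> 'k qtorus \<Rightarrow> 'k qtorus" where
  "qt_scale c f = Poly_Mapping.map (\<lambda>x. c * x) f"

definition qt_inverse :: "nat \<Rightarrow> (rat \<Rightarrow> 'k::field) \<Rightarrow> 'k qtorus \<Rightarrow> 'k qtorus" where
  "qt_inverse n qp f = (THE g. qt_mult n qp f g = Zmon 0 \<and> qt_mult n qp g f = Zmon 0)"

text \<open>\<open>weyl A r\<close> is the normally ordered monomial \<open>:\<Prod>\<^sub>\<alpha>\<^sub>\<in>\<^sub>A Z\<^sub>\<alpha>\<^bsup>r \<alpha>\<^esup>:\<close>.\<close>

definition weyl :: "face set \<Rightarrow> (face \<Rightarrow> rat) \<Rightarrow> ('k::field) qtorus" where
  "weyl A r = Zmon (\<Sum>\<alpha>\<in>A. Poly_Mapping.single \<alpha> (r \<alpha>))"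

lemma skew_form_zero [simp]: "skew_form n 0 \<mu> = 0" "skew_form n \<kappa> 0 = 0"
  by (simp_all add: skew_form_def)

lemma skew_form_uminus:
  "skew_form n (- \<kappa>) \<mu> = - skew_form n \<kappa> \<mu>" "skew_form n \<kappa> (- \<mu>) = - skew_form n \<kappa> \<mu>"
  by (simp_all add: skew_form_def sum_negf)

lemma skew_form_antisym: "skew_form n \<mu> \<kappa> = - skew_form n \<kappa> \<mu>"
proof -
  have "skew_form n \<mu> \<kappa> = (\<Sum>\<beta>\<in>faces n. \<Sum>\<alpha>\<in>faces n.
          Poly_Mapping.lookup \<mu> \<alpha> * Poly_Mapping.lookup \<kappa> \<beta> * face_form n \<alpha> \<beta>)"
    unfolding skew_form_def by (rule sum.swap)
  also have "\<dots> = - skew_form n \<kappa> \<mu>"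
    unfolding skew_form_def sum_negf[symmetric]
    by (intro sum.cong refl) (simp add: face_form_def field_simps)
  finally show ?thesis .
qed

lemma skew_form_self [simp]: "skew_form n \<kappa> \<kappa> = 0"
  using skew_form_antisym[of n \<kappa> \<kappa>] by simp

lemma qt_mult_Zmon: "qt_mult n qp (Zmon \<kappa>) (Zmon \<mu>) = qt_scale (qp (- skew_form n \<kappa> \<mu>)) (Zmon (\<kappa> + \<mu>))"
  by (simp add: qt_mult_def qt_scale_def Zmon_def)

lemma qt_scale_one: "qt_scale 1 f = f"
  by (rule poly_mapping_eqI) (simp add: qt_scale_def Poly_Mapping.map.rep_eq when_def)

lemma qt_inverse_Zmon:
  fixes qp :: "rat \<Rightarrow> 'k::field"
  assumes "formal_rational_powers qp"
  shows "qt_inverse n qp (Zmon \<kappa>) = Zmon (- \<kappa>)"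
  unfolding qt_inverse_def
proof (rule the_equality)
  have q0: "qp 0 = 1" and qadd: "\<And>r s. qp (r + s) = qp r * qp s"
    using assms by (auto simp: formal_rational_powers_def)
  have qnz: "qp r \<noteq> 0" for r
    using qadd[of r "- r"] q0 by auto
  show "qt_mult n qp (Zmon \<kappa>) (Zmon (- \<kappa>)) = Zmon 0 \<and> qt_mult n qp (Zmon (- \<kappa>)) (Zmon \<kappa>) = Zmon 0"
    by (simp add: qt_mult_Zmon skew_form_uminus q0 qt_scale_one)
  fix g assume "qt_mult n qp (Zmon \<kappa>) g = Zmon 0 \<and> qt_mult n qp g (Zmon \<kappa>) = Zmon 0"
  then have g: "qt_mult n qp (Zmon \<kappa>) g = Zmon 0" by simp
  show "g = Zmon (- \<kappa>)"
  proof (rule poly_mapping_eqI)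
    fix \<mu>
    have "Poly_Mapping.lookup (qt_mult n qp (Zmon \<kappa>) g) (\<kappa> + \<mu>)
        = (\<Sum>\<nu>\<in>Poly_Mapping.keys g. if \<nu> = \<mu>
             then qp (- skew_form n \<kappa> \<nu>) * Poly_Mapping.lookup g \<nu> else 0)"
      by (simp add: qt_mult_def Zmon_def lookup_sum lookup_single when_def)
    also have "\<dots> = qp (- skew_form n \<kappa> \<mu>) * Poly_Mapping.lookup g \<mu>"
      by (simp add: sum.delta in_keys_iff)
    finally have *: "Poly_Mapping.lookup (Zmon 0 :: 'k qtorus) (\<kappa> + \<mu>)
        = qp (- skew_form n \<kappa> \<mu>) * Poly_Mapping.lookup g \<mu>"
      using g by simp
    show "Poly_Mapping.lookup g \<mu> = Poly_Mapping.lookup (Zmon (- \<kappa>)) \<mu>"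
    proof (cases "\<mu> = - \<kappa>")
      case True
      then show ?thesis using * by (simp add: Zmon_def skew_form_uminus q0)
    next
      case False
      then have "\<kappa> + \<mu> \<noteq> 0" by (metis add.commute eq_neg_iff_add_eq_0)
      then show ?thesis using * False qnz by (simp add: Zmon_def lookup_single when_def lookup_one)
    qed
  qed
qed

section \<open>The network\<close>

datatype vertex =
    White nat nat nat
  | Black nat nat nat
  | Source nat
  | LeftSink nat
  | BottomSink nat

text \<open>\<open>net_arc n u v \<alpha> \<beta>\<close>: there is an edge \<open>u \<rightarrow> v\<close>, with face \<open>\<alpha>\<close> on its right and face \<open>\<beta>\<close> on its
  left.  The white (black) triangle of \<open>w\<^sub>a\<^sub>b\<^sub>c\<close> (\<open>b\<^sub>a\<^sub>b\<^sub>c\<close>) has as corners the three faces in its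
  half-arrows, and an edge crosses the side shared by its two triangles (or the boundary side of
  its white triangle), so \<open>\<alpha>\<close> and \<open>\<beta>\<close> are the ends of that side.  In the first two rules the
  index that is decreased along the edge is written as a successor.\<close>

inductive net_arc :: "nat \<Rightarrow> vertex \<Rightarrow> vertex \<Rightarrow> face \<Rightarrow> face \<Rightarrow> bool" for n where
  white_black_b: "a + (b+1) + c + 1 = n \<Longrightarrow>
    net_arc n (White a (b+1) c) (Black a b c) (a, b+1, c+1) (a+1, b+1, c)"
| white_black_c: "a + b + (c+1) + 1 = n \<Longrightarrow>
    net_arc n (White a b (c+1)) (Black a b c) (a+1, b, c+1) (a, b+1, c+1)"
| black_white: "a + b + c + 2 = n \<Longrightarrow>
    net_arc n (Black a b c) (White (a+1) b c) (a+1, b, c+1) (a+1, b+1, c)"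
| source: "1 \<le> i \<Longrightarrow> i \<le> n \<Longrightarrow>
    net_arc n (Source i) (White 0 (i-1) (n-i)) (0, i-1, n-i+1) (0, i, n-i)"
| left_sink: "1 \<le> i \<Longrightarrow> i \<le> n \<Longrightarrow>
    net_arc n (White (i-1) 0 (n-i)) (LeftSink i) (i-1, 0, n-i+1) (i, 0, n-i)"
| bottom_sink: "1 \<le> i \<Longrightarrow> i \<le> n \<Longrightarrow>
    net_arc n (White (n-i) (i-1) 0) (BottomSink i) (n-i+1, i-1, 0) (n-i, i, 0)"

definition network :: "nat \<Rightarrow> (vertex, vertex \<times> vertex) pre_digraph" where
  "network n =
     \<lparr>verts = {White a b c | a b c. a + b + c + 1 = n} \<union> {Black a b c | a b c. a + b + c + 2 = n}
              \<union> Source ` {1..n} \<union> LeftSink ` {1..n} \<union> BottomSink ` {1..n},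
      arcs = {(u, v). \<exists>\<alpha> \<beta>. net_arc n u v \<alpha> \<beta>},
      tail = fst, head = snd\<rparr>"

text \<open>The sums over directed paths below are finite sums.\<close>

lemma fin_digraph_network: "fin_digraph (network n)"
proof
  let ?T = "{..n} \<times> {..n} \<times> {..n}"
  have 1: "{White a b c | a b c. a + b + c + 1 = n} \<subseteq> (\<lambda>(a, b, c). White a b c) ` ?T"
   and 2: "{Black a b c | a b c. a + b + c + 2 = n} \<subseteq> (\<lambda>(a, b, c). Black a b c) ` ?T"
    by (auto simp: image_iff Bex_def)
  show fv: "finite (verts (network n))"
    using finite_subset[OF 1] finite_subset[OF 2] by (simp add: network_def)
  have e: "u \<in> verts (network n) \<and> v \<in> verts (network n)" if "net_arc n u v \<alpha> \<beta>" for u v \<alpha> \<beta>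
    using that by cases (auto simp: network_def)
  show "tail (network n) a \<in> verts (network n)" "head (network n) a \<in> verts (network n)"
    if a: "a \<in> arcs (network n)" for a
  proof -
    obtain u v \<alpha> \<beta> where "a = (u, v)" "net_arc n u v \<alpha> \<beta>"
      using a by (cases a) (auto simp: network_def)
    then have "fst a \<in> verts (network n)" "snd a \<in> verts (network n)"
      using e by simp_all
    then show "tail (network n) a \<in> verts (network n)" "head (network n) a \<in> verts (network n)"
      by (simp_all add: network_def)
  qed
  have "arcs (network n) \<subseteq> verts (network n) \<times> verts (network n)"
  proof
    fix a assume "a \<in> arcs (network n)"
    then obtain u v \<alpha> \<beta> where "a = (u, v)" "net_arc n u v \<alpha> \<beta>"
      by (cases a) (auto simp: network_def)
    then show "a \<in> verts (network n) \<times> verts (network n)"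
      using e by simp
  qed
  then show "finite (arcs (network n))"
    using fv finite_subset by blast
qed

lemma finite_network_paths: "finite {P. pre_digraph.apath (network n) u P v}"
proof -
  interpret fin_digraph "network n" by (rule fin_digraph_network)
  show ?thesis by (rule apaths_finite)
qed

text \<open>A path from a source to a sink cuts the disk into two parts.  Two faces lie in the same part
  iff they are joined by a chain of faces, consecutive ones sharing an edge not on the path; the
  right part consists of the faces so joined to a face immediately to the right of the path.\<close>

definition right_faces :: "nat \<Rightarrow> (vertex \<times> vertex) awalk \<Rightarrow> face set" where
  "right_faces n P =
     {(\<alpha>, \<beta>). \<exists>u v. (net_arc n u v \<alpha> \<beta> \<or> net_arc n u v \<beta> \<alpha>) \<and> (u, v) \<notin> set P}\<^sup>*
       `` {\<alpha>. \<exists>u v \<beta>. (u, v) \<in> set P \<and> net_arc n u v \<alpha> \<beta>}"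

definition path_weight :: "nat \<Rightarrow> (vertex \<times> vertex) awalk \<Rightarrow> ('k::field) qtorus" where
  "path_weight n P = weyl (right_faces n P) (\<lambda>_. 1)"

section \<open>Transport matrices\<close>

text \<open>Matrices are functions on indices; only the indices in \<open>{1..n}\<close> matter.\<close>

definition net_matrix :: "nat \<Rightarrow> (nat \<Rightarrow> vertex) \<Rightarrow> nat \<Rightarrow> nat \<Rightarrow> ('k::field) qtorus" where
  "net_matrix n sink i j =
     (\<Sum>P\<in>{P. pre_digraph.apath (network n) (Source j) P (sink i)}. path_weight n P)"

definition D1 :: "nat \<Rightarrow> ('k::field) qtorus" where
  "D1 n = weyl (faces n) (\<lambda>(a, b, c). of_nat c / of_nat n)"

definition D2 :: "nat \<Rightarrow> ('k::field) qtorus" where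
  "D2 n = weyl (faces n) (\<lambda>(a, b, c). of_nat a / of_nat n)"

definition Q_mat :: "(rat \<Rightarrow> 'k::field) \<Rightarrow> nat \<Rightarrow> nat \<Rightarrow> 'k" where
  "Q_mat qp i j = (if i = j then qp (1/2 - of_nat j) else 0)"

definition S_mat :: "nat \<Rightarrow> nat \<Rightarrow> nat \<Rightarrow> 'k::field" where
  "S_mat n i j = (if i = n + 1 - j then (-1) ^ (n - i) else 0)"

definition scalar_mat_mult ::
    "nat \<Rightarrow> (nat \<Rightarrow> nat \<Rightarrow> 'k::field) \<Rightarrow> (nat \<Rightarrow> nat \<Rightarrow> 'k qtorus) \<Rightarrow> nat \<Rightarrow> nat \<Rightarrow> 'k qtorus" where
  "scalar_mat_mult n A X i j = (\<Sum>k=1..n. qt_scale (A i k) (X k j))"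

definition M1 :: "nat \<Rightarrow> (rat \<Rightarrow> 'k::field) \<Rightarrow> nat \<Rightarrow> nat \<Rightarrow> 'k qtorus" where
  "M1 n qp i j =
     qt_mult n qp
       (scalar_mat_mult n (Q_mat qp) (scalar_mat_mult n (S_mat n) (net_matrix n LeftSink)) i j)
       (qt_inverse n qp (D1 n))"

definition M2 :: "nat \<Rightarrow> (rat \<Rightarrow> 'k::field) \<Rightarrow> nat \<Rightarrow> nat \<Rightarrow> 'k qtorus" where
  "M2 n qp i j =
     qt_mult n qp
       (qt_mult n qp
         (scalar_mat_mult n (Q_mat qp) (scalar_mat_mult n (S_mat n) (net_matrix n BottomSink)) i j)
         (qt_inverse n qp (D1 n)))
       (qt_inverse n qp (D2 n))"

section \<open>Tensor notation and the \<open>R\<close>-matrix\<close>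

text \<open>Matrices on the tensor square have row and column indices in \<open>{1..n} \<times> {1..n}\<close>.\<close>

definition kron :: "(nat \<Rightarrow> nat \<Rightarrow> 'k::field) \<Rightarrow> (nat \<Rightarrow> nat \<Rightarrow> 'k) \<Rightarrow> nat \<times> nat \<Rightarrow> nat \<times> nat \<Rightarrow> 'k" where
  "kron A B = (\<lambda>(i, k) (j, l). A i j * B k l)"

definition matrix_unit :: "nat \<Rightarrow> nat \<Rightarrow> nat \<Rightarrow> nat \<Rightarrow> 'k::field" where
  "matrix_unit a b i j = (if i = a \<and> j = b then 1 else 0)"

definition R_mat :: "nat \<Rightarrow> (rat \<Rightarrow> 'k::field) \<Rightarrow> nat \<times> nat \<Rightarrow> nat \<times> nat \<Rightarrow> 'k" where
  "R_mat n qp x y =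
     qp (- (1 / of_nat n)) *
       ((\<Sum>i=1..n. \<Sum>j=1..n. kron (matrix_unit i i) (matrix_unit j j) x y)
        + (qp 1 - 1) * (\<Sum>i=1..n. kron (matrix_unit i i) (matrix_unit i i) x y)
        + (qp 1 - qp (-1)) *
            (\<Sum>(i, j)\<in>{(i, j). i \<in> {1..n} \<and> j \<in> {1..n} \<and> i > j}.
               kron (matrix_unit i j) (matrix_unit j i) x y))"

definition total_transpose :: "(nat \<times> nat \<Rightarrow> nat \<times> nat \<Rightarrow> 'k) \<Rightarrow> nat \<times> nat \<Rightarrow> nat \<times> nat \<Rightarrow> 'k" where
  "total_transpose R x y = R y x"

text \<open>\<open>tensor12 n qp M N\<close> has \<open>M\<close> in the first and \<open>N\<close> in the second factor, with entries of \<open>M\<close>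
  written first; \<open>tensor21 n qp N M\<close> has \<open>N\<close> in the second and \<open>M\<close> in the first factor, with
  entries of \<open>N\<close> written first.\<close>

definition tensor12 ::
    "nat \<Rightarrow> (rat \<Rightarrow> 'k::field) \<Rightarrow> (nat \<Rightarrow> nat \<Rightarrow> 'k qtorus) \<Rightarrow> (nat \<Rightarrow> nat \<Rightarrow> 'k qtorus)
      \<Rightarrow> nat \<times> nat \<Rightarrow> nat \<times> nat \<Rightarrow> 'k qtorus" where
  "tensor12 n qp M N = (\<lambda>(i, k) (j, l). qt_mult n qp (M i j) (N k l))"

definition tensor21 ::
    "nat \<Rightarrow> (rat \<Rightarrow> 'k::field) \<Rightarrow> (nat \<Rightarrow> nat \<Rightarrow> 'k qtorus) \<Rightarrow> (nat \<Rightarrow> nat \<Rightarrow> 'k qtorus)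
      \<Rightarrow> nat \<times> nat \<Rightarrow> nat \<times> nat \<Rightarrow> 'k qtorus" where
  "tensor21 n qp N M = (\<lambda>(i, k) (j, l). qt_mult n qp (N k l) (M i j))"

definition scalar_left ::
    "nat \<Rightarrow> (nat \<times> nat \<Rightarrow> nat \<times> nat \<Rightarrow> 'k::field) \<Rightarrow> (nat \<times> nat \<Rightarrow> nat \<times> nat \<Rightarrow> 'k qtorus)
      \<Rightarrow> nat \<times> nat \<Rightarrow> nat \<times> nat \<Rightarrow> 'k qtorus" where
  "scalar_left n R X x y = (\<Sum>z\<in>{1..n} \<times> {1..n}. qt_scale (R x z) (X z y))"

definition scalar_right ::
    "nat \<Rightarrow> (nat \<times> nat \<Rightarrow> nat \<times> nat \<Rightarrow> 'k qtorus) \<Rightarrow> (nat \<times> nat \<Rightarrow> nat \<times> nat \<Rightarrow> 'k::field)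
      \<Rightarrow> nat \<times> nat \<Rightarrow> nat \<times> nat \<Rightarrow> 'k qtorus" where
  "scalar_right n X R x y = (\<Sum>z\<in>{1..n} \<times> {1..n}. qt_scale (R z y) (X x z))"

end

theory Submission
  imports Defs
begin

text \<open>Call the faces with first coordinate \<open>a\<close> the line \<open>a\<close>.  A path from a source crosses the lines
  \<open>0, 1, 2, \<dots>\<close> one after another.  On the line \<open>n - m\<close> it passes just below the face with last
  coordinate \<open>e\<close>, so exactly the faces with \<open>c \<ge> e\<close> of that line are on its right, and from one line
  to the next \<open>e\<close> either stays or drops by one.  A path is therefore a sequence of states \<open>e\<close>; it has
  left the network at the left side once \<open>e = m + 1\<close> (nothing of the line is on its right) and at the
  bottom side once \<open>e = 0\<close>.  The lists \<open>routes\<close> produce the paths with their right regions by this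
  recursion; \<open>net_matrix_routes\<close> shows that they give the network matrices, where the right side of
  a path is defined topologically.

  The skew form is a sum over triangles, and the triangles between two consecutive lines form a
  strip.  A strip contributes to the pairing of two right regions only \<open>0\<close> or \<open>\<plusminus>1/2\<close>, depending only
  on the two steps across the strip (\<open>form_beyond_crossing\<close>).  So the product of two path sums,
  \<open>pair_sum\<close>, obeys a recursion with four terms in the commutative group algebra of the exponents
  (\<open>pair_sum_step\<close>): a strip acts as an \<open>L\<close>-operator with two entries in each row.  Two relations
  reproduce themselves under this recursion: the exchange relation for two different sinks
  (\<open>pair_sum_exchange\<close>) and the \<open>q\<close>-commutation for one sink (\<open>pair_sum_same_sink\<close>).  They start at
  the exits, where the remaining region of one path is empty or full and pairs to zero with the
  other region.

  The \<open>2n\<close> sinks are numbered along the boundary, left sinks first.  Both entries of a product may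
  then be taken from either matrix, and the \<open>R\<close>-matrix acts on the rows through the order of the
  sinks.  Since every left sink precedes every bottom sink, only the \<open>R\<close>-matrix acting on the
  sources remains in the mixed relation.

  The normalizing monomials pair with any vector through two of its corner coordinates only
  (\<open>skew_form_height\<close>, \<open>skew_form_depth\<close>), and whether a corner face lies on the right of a path
  depends only on the side where the path ends.  Hence \<open>D\<^sub>1\<close> and \<open>D\<^sub>2\<close> contribute constant powers of
  \<open>q\<close>; these cancel in the relations within one matrix and account for the prefactor \<open>q\<^bsup>-1/n\<^esup>\<close> of the
  \<open>R\<close>-matrix in the mixed relation.\<close>

section \<open>The skew form as a sum over triangles\<close>

text \<open>The contribution of the three half-arrows \<open>x \<rightarrow> y \<rightarrow> z \<rightarrow> x\<close> to the skew form.  It vanishes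
  when one of the arguments is constant on the triangle.\<close>

definition triangle_form :: "(face \<Rightarrow> rat) \<Rightarrow> (face \<Rightarrow> rat) \<Rightarrow> face \<Rightarrow> face \<Rightarrow> face \<Rightarrow> rat" where
  "triangle_form \<kappa> \<mu> x y z =
     (\<kappa> x * (\<mu> y - \<mu> z) + \<kappa> y * (\<mu> z - \<mu> x) + \<kappa> z * (\<mu> x - \<mu> y)) / 2"

fun white_form :: "(face \<Rightarrow> rat) \<Rightarrow> (face \<Rightarrow> rat) \<Rightarrow> face \<Rightarrow> rat" where
  "white_form \<kappa> \<mu> (a, b, c) = triangle_form \<kappa> \<mu> (a+1, b, c) (a, b, c+1) (a, b+1, c)"

fun black_form :: "(face \<Rightarrow> rat) \<Rightarrow> (face \<Rightarrow> rat) \<Rightarrow> face \<Rightarrow> rat" where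
  "black_form \<kappa> \<mu> (a, b, c) = triangle_form \<kappa> \<mu> (a+1, b, c+1) (a+1, b+1, c) (a, b+1, c+1)"

text \<open>The faces (\<open>k = 0\<close>), white triangles (\<open>k = 1\<close>) and black triangles (\<open>k = 2\<close>) on or beyond the line
  \<open>a\<close>, as seen from the sources.\<close>

definition cells :: "nat \<Rightarrow> nat \<Rightarrow> nat \<Rightarrow> face set" where
  "cells n k a = {(a', b, c). a' + b + c + k = n \<and> a \<le> a'}"

text \<open>The skew form of the smaller triangular array cut off by the line \<open>a\<close>.  On that line it counts
  only the half-arrows on the far side, which is what makes it suitable for an induction on the
  number of remaining lines.\<close>

definition form_beyond :: "nat \<Rightarrow> nat \<Rightarrow> (face \<Rightarrow> rat) \<Rightarrow> (face \<Rightarrow> rat) \<Rightarrow> rat" where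
  "form_beyond n a \<kappa> \<mu> =
     (\<Sum>t\<in>cells n 1 a. white_form \<kappa> \<mu> t) + (\<Sum>t\<in>cells n 2 a. black_form \<kappa> \<mu> t)"

lemma finite_cells [simp]: "finite (cells n k a)"
proof -
  have "cells n k a \<subseteq> {..n} \<times> {..n} \<times> {..n}" by (auto simp: cells_def)
  then show ?thesis by (rule finite_subset) simp
qed

lemma faces_cells: "faces n = cells n 0 0"
  by (auto simp: faces_def cells_def)

lemma finite_faces [simp]: "finite (faces n)"
  by (simp add: faces_cells)

lemma sum_pairs_indicator:
  fixes g :: "'a \<Rightarrow> 'a \<Rightarrow> rat"
  assumes "finite F" "A \<subseteq> F \<times> F"
  shows "(\<Sum>\<alpha>\<in>F. \<Sum>\<beta>\<in>F. g \<alpha> \<beta> * of_bool ((\<alpha>, \<beta>) \<in> A)) = (\<Sum>(\<alpha>, \<beta>)\<in>A. g \<alpha> \<beta>)"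
proof -
  have "(\<Sum>\<alpha>\<in>F. \<Sum>\<beta>\<in>F. g \<alpha> \<beta> * of_bool ((\<alpha>, \<beta>) \<in> A))
      = (\<Sum>x\<in>F \<times> F. if x \<in> A then (case x of (\<alpha>, \<beta>) \<Rightarrow> g \<alpha> \<beta>) else 0)"
    by (simp add: sum.cartesian_product of_bool_def if_distrib split_def cong: if_cong)
  also have "\<dots> = (\<Sum>x\<in>(F \<times> F) \<inter> A. (case x of (\<alpha>, \<beta>) \<Rightarrow> g \<alpha> \<beta>))"
    using assms(1) by (simp add: sum.inter_restrict)
  finally show ?thesis using assms(2) by (simp add: Int_absorb1)
qed

lemma card_sum_of_bool: "finite S \<Longrightarrow> (of_nat (card {t \<in> S. P t}) :: rat) = (\<Sum>t\<in>S. of_bool (P t))"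
  by (simp add: of_bool_def sum.If_cases Int_def)

lemma half_arrow_form:
  fixes A :: "face \<Rightarrow> (face \<times> face) set" and \<kappa> \<mu> :: "face \<Rightarrow> rat"
  assumes "finite F" "finite S" "\<And>t. t \<in> S \<Longrightarrow> A t \<subseteq> F \<times> F"
  shows "(\<Sum>\<alpha>\<in>F. \<Sum>\<beta>\<in>F. \<kappa> \<alpha> * \<mu> \<beta> *
            (of_nat (card {t \<in> S. (\<alpha>, \<beta>) \<in> A t}) - of_nat (card {t \<in> S. (\<beta>, \<alpha>) \<in> A t})))
       = (\<Sum>t\<in>S. \<Sum>(\<alpha>, \<beta>)\<in>A t. \<kappa> \<alpha> * \<mu> \<beta> - \<kappa> \<beta> * \<mu> \<alpha>)"
proof -
  have one: "(\<Sum>\<alpha>\<in>F. \<Sum>\<beta>\<in>F. h \<alpha> \<beta> * of_nat (card {t \<in> S. (\<alpha>, \<beta>) \<in> A t}))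
      = (\<Sum>t\<in>S. \<Sum>(\<alpha>, \<beta>)\<in>A t. h \<alpha> \<beta>)" for h :: "face \<Rightarrow> face \<Rightarrow> rat"
  proof -
    have "(\<Sum>\<alpha>\<in>F. \<Sum>\<beta>\<in>F. h \<alpha> \<beta> * of_nat (card {t \<in> S. (\<alpha>, \<beta>) \<in> A t}))
      = (\<Sum>\<alpha>\<in>F. \<Sum>\<beta>\<in>F. \<Sum>t\<in>S. h \<alpha> \<beta> * of_bool ((\<alpha>, \<beta>) \<in> A t))"
      using assms(2) by (simp only: card_sum_of_bool sum_distrib_left)
    also have "\<dots> = (\<Sum>\<alpha>\<in>F. \<Sum>t\<in>S. \<Sum>\<beta>\<in>F. h \<alpha> \<beta> * of_bool ((\<alpha>, \<beta>) \<in> A t))"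
      by (intro sum.cong refl sum.swap)
    also have "\<dots> = (\<Sum>t\<in>S. \<Sum>\<alpha>\<in>F. \<Sum>\<beta>\<in>F. h \<alpha> \<beta> * of_bool ((\<alpha>, \<beta>) \<in> A t))"
      by (rule sum.swap)
    also have "\<dots> = (\<Sum>t\<in>S. \<Sum>(\<alpha>, \<beta>)\<in>A t. h \<alpha> \<beta>)"
      by (intro sum.cong refl sum_pairs_indicator assms)
    finally show ?thesis .
  qed
  have "(\<Sum>\<alpha>\<in>F. \<Sum>\<beta>\<in>F. \<kappa> \<alpha> * \<mu> \<beta> *
            (of_nat (card {t \<in> S. (\<alpha>, \<beta>) \<in> A t}) - of_nat (card {t \<in> S. (\<beta>, \<alpha>) \<in> A t})))
    = (\<Sum>\<alpha>\<in>F. \<Sum>\<beta>\<in>F. \<kappa> \<alpha> * \<mu> \<beta> * of_nat (card {t \<in> S. (\<alpha>, \<beta>) \<in> A t}))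
      - (\<Sum>\<alpha>\<in>F. \<Sum>\<beta>\<in>F. \<kappa> \<alpha> * \<mu> \<beta> * of_nat (card {t \<in> S. (\<beta>, \<alpha>) \<in> A t}))"
    by (simp add: right_diff_distrib sum_subtractf)
  also have "(\<Sum>\<alpha>\<in>F. \<Sum>\<beta>\<in>F. \<kappa> \<alpha> * \<mu> \<beta> * of_nat (card {t \<in> S. (\<beta>, \<alpha>) \<in> A t}))
    = (\<Sum>\<beta>\<in>F. \<Sum>\<alpha>\<in>F. \<kappa> \<alpha> * \<mu> \<beta> * of_nat (card {t \<in> S. (\<beta>, \<alpha>) \<in> A t}))"
    by (rule sum.swap)
  finally show ?thesis
    by (simp add: one[of "\<lambda>\<alpha> \<beta>. \<kappa> \<alpha> * \<mu> \<beta>"] one[of "\<lambda>\<beta> \<alpha>. \<kappa> \<alpha> * \<mu> \<beta>"] split_def sum_subtractf)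
qed

text \<open>Summing over half-arrows triangle by triangle gives the same value as summing over pairs of
  faces with multiplicities.\<close>

lemma skew_form_triangles:
  "skew_form n \<kappa> \<mu> = form_beyond n 0 (Poly_Mapping.lookup \<kappa>) (Poly_Mapping.lookup \<mu>)"
proof -
  let ?k = "Poly_Mapping.lookup \<kappa>" and ?m = "Poly_Mapping.lookup \<mu>"
  let ?W = "cells n 1 0" and ?B = "cells n 2 0"
  have N: "num_half_arrows n \<alpha> \<beta> = card {t \<in> ?W. (\<alpha>, \<beta>) \<in> white_half_arrows t}
      + card {t \<in> ?B. (\<alpha>, \<beta>) \<in> black_half_arrows t}" for \<alpha> \<beta>
    unfolding num_half_arrows_def
    by (intro arg_cong2[where f = "(+)"] arg_cong[where f = card]) (auto simp: cells_def)
  have w: "(\<Sum>(\<alpha>, \<beta>)\<in>white_half_arrows t. ?k \<alpha> * ?m \<beta> - ?k \<beta> * ?m \<alpha>) = 2 * white_form ?k ?m t" for t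
    by (cases t) (simp add: triangle_form_def algebra_simps)
  have b: "(\<Sum>(\<alpha>, \<beta>)\<in>black_half_arrows t. ?k \<alpha> * ?m \<beta> - ?k \<beta> * ?m \<alpha>) = 2 * black_form ?k ?m t" for t
    by (cases t) (simp add: triangle_form_def algebra_simps)
  have "2 * skew_form n \<kappa> \<mu> =
     (\<Sum>\<alpha>\<in>faces n. \<Sum>\<beta>\<in>faces n. ?k \<alpha> * ?m \<beta> * (of_nat (card {t \<in> ?W. (\<alpha>, \<beta>) \<in> white_half_arrows t})
        - of_nat (card {t \<in> ?W. (\<beta>, \<alpha>) \<in> white_half_arrows t})))
   + (\<Sum>\<alpha>\<in>faces n. \<Sum>\<beta>\<in>faces n. ?k \<alpha> * ?m \<beta> * (of_nat (card {t \<in> ?B. (\<alpha>, \<beta>) \<in> black_half_arrows t})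
        - of_nat (card {t \<in> ?B. (\<beta>, \<alpha>) \<in> black_half_arrows t})))"
    unfolding skew_form_def face_form_def N sum_distrib_left sum.distrib[symmetric]
    by (intro sum.cong refl) (simp add: field_simps)
  also have "\<dots> = (\<Sum>t\<in>?W. 2 * white_form ?k ?m t) + (\<Sum>t\<in>?B. 2 * black_form ?k ?m t)"
  proof -
    have wsub: "white_half_arrows t \<subseteq> faces n \<times> faces n" if "t \<in> ?W" for t
      using that by (auto simp: faces_def cells_def)
    have bsub: "black_half_arrows t \<subseteq> faces n \<times> faces n" if "t \<in> ?B" for t
      using that by (auto simp: faces_def cells_def)
    have "(\<Sum>\<alpha>\<in>faces n. \<Sum>\<beta>\<in>faces n. ?k \<alpha> * ?m \<beta> * (of_nat (card {t \<in> ?W. (\<alpha>, \<beta>) \<in> white_half_arrows t})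
        - of_nat (card {t \<in> ?W. (\<beta>, \<alpha>) \<in> white_half_arrows t}))) = (\<Sum>t\<in>?W. 2 * white_form ?k ?m t)"
      using half_arrow_form[OF finite_faces finite_cells wsub, where \<kappa> = ?k and \<mu> = ?m] by (simp only: w)
    moreover have "(\<Sum>\<alpha>\<in>faces n. \<Sum>\<beta>\<in>faces n. ?k \<alpha> * ?m \<beta> * (of_nat (card {t \<in> ?B. (\<alpha>, \<beta>) \<in>
        black_half_arrows t})
        - of_nat (card {t \<in> ?B. (\<beta>, \<alpha>) \<in> black_half_arrows t}))) = (\<Sum>t\<in>?B. 2 * black_form ?k ?m t)"
      using half_arrow_form[OF finite_faces finite_cells bsub, where \<kappa> = ?k and \<mu> = ?m] by (simp only: b)
    ultimately show ?thesis by simp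
  qed
  finally show ?thesis
    by (simp add: form_beyond_def sum_distrib_left[symmetric])
qed

lemma form_beyond_antisym: "form_beyond n a \<mu> \<kappa> = - form_beyond n a \<kappa> \<mu>"
proof -
  have "white_form \<mu> \<kappa> t = - white_form \<kappa> \<mu> t" "black_form \<mu> \<kappa> t = - black_form \<kappa> \<mu> t" for t
    by (cases t; simp add: triangle_form_def field_simps)+
  then show ?thesis by (simp add: form_beyond_def sum_negf)
qed

lemma form_beyond_cong:
  assumes "\<And>\<alpha>. \<alpha> \<in> cells n 0 a \<Longrightarrow> \<kappa> \<alpha> = \<kappa>' \<alpha>" "\<And>\<alpha>. \<alpha> \<in> cells n 0 a \<Longrightarrow> \<mu> \<alpha> = \<mu>' \<alpha>"
  shows "form_beyond n a \<kappa> \<mu> = form_beyond n a \<kappa>' \<mu>'"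
  unfolding form_beyond_def
  by (intro arg_cong2[where f = "(+)"] sum.cong refl)
     (auto simp: triangle_form_def cells_def assms)

lemma form_beyond_const:
  assumes "\<And>\<alpha>. \<alpha> \<in> cells n 0 a \<Longrightarrow> \<kappa> \<alpha> = k"
  shows "form_beyond n a \<kappa> \<mu> = 0"
proof -
  have "form_beyond n a \<kappa> \<mu> = form_beyond n a (\<lambda>_. k) \<mu>"
    by (rule form_beyond_cong) (auto simp: assms)
  also have "\<dots> = 0"
  proof -
    have "white_form (\<lambda>_. k) \<mu> t = 0" "black_form (\<lambda>_. k) \<mu> t = 0" for t
      by (cases t; simp add: triangle_form_def algebra_simps)+
    then show ?thesis by (simp add: form_beyond_def)
  qed
  finally show ?thesis .
qed

lemma form_beyond_const_right:
  assumes "\<And>\<alpha>. \<alpha> \<in> cells n 0 a \<Longrightarrow> \<mu> \<alpha> = k"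
  shows "form_beyond n a \<kappa> \<mu> = 0"
  using form_beyond_const[OF assms, where \<mu> = \<kappa>] form_beyond_antisym[of n a \<kappa> \<mu>] by simp

text \<open>The strip between the lines \<open>a\<close> and \<open>a + 1\<close> consists of the triangles with first coordinate \<open>a\<close>.\<close>

lemma form_beyond_step:
  assumes "a + Suc m = n"
  shows "form_beyond n a \<kappa> \<mu> = (\<Sum>c\<le>m. white_form \<kappa> \<mu> (a, m - c, c))
     + (\<Sum>c<m. black_form \<kappa> \<mu> (a, m - Suc c, c)) + form_beyond n (Suc a) \<kappa> \<mu>"
proof -
  have W: "cells n 1 a
     = (\<lambda>c. (a, m - c, c)) ` {..m} \<union> cells n 1 (Suc a)"
    using assms by (force simp: image_iff cells_def)
  have B: "cells n 2 a
     = (\<lambda>c. (a, m - Suc c, c)) ` {..<m} \<union> cells n 2 (Suc a)"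
    using assms by (force simp: image_iff cells_def)
  have "(\<lambda>c. (a, m - c, c)) ` {..m} \<inter> cells n 1 (Suc a) = {}"
    and "(\<lambda>c. (a, m - Suc c, c)) ` {..<m} \<inter> cells n 2 (Suc a) = {}"
    by (auto simp: cells_def)
  then show ?thesis
    unfolding form_beyond_def W B
    by (simp add: sum.union_disjoint sum.reindex inj_on_def)
qed

section \<open>Crossing a strip\<close>

definition profile :: "nat \<Rightarrow> nat \<Rightarrow> nat \<Rightarrow> face set \<Rightarrow> bool" where
  "profile n a e U \<longleftrightarrow> (\<forall>b c. a + b + c = n \<longrightarrow> ((a, b, c) \<in> U \<longleftrightarrow> e \<le> c))"

text \<open>The contribution of one strip to the pairing of the right regions of two paths that enter it
  in the states \<open>e\<close> and \<open>f\<close> and leave it in the states \<open>e - s\<close> and \<open>f - t\<close>.  It is nonzero exactly if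
  the two paths separate in the strip after a common entry, or meet at the end of the strip.\<close>

definition crossing :: "nat \<Rightarrow> nat \<Rightarrow> nat \<Rightarrow> nat \<Rightarrow> rat" where
  "crossing e s f t =
     (if e = f then (of_nat s - of_nat t) / 2
      else of_bool (f = e + 1 \<and> s = 0 \<and> t = 1) / 2 - of_bool (e = f + 1 \<and> s = 1 \<and> t = 0) / 2)"

abbreviation ind :: "face set \<Rightarrow> face \<Rightarrow> rat" where
  "ind U \<alpha> \<equiv> of_bool (\<alpha> \<in> U)"

text \<open>The indicator function of a right region is constant on all triangles of the strip except those
  that the path visits: one white triangle and at most one black triangle.  So only triangles
  visited by both paths contribute.\<close>

lemma form_beyond_crossing:
  assumes n: "a + Suc m = n"
    and e: "1 \<le> e" "e \<le> Suc m" "s \<le> 1" and f: "1 \<le> f" "f \<le> Suc m" "t \<le> 1"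
    and U: "profile n a e U" "profile n (Suc a) (e - s) U"
    and V: "profile n a f V" "profile n (Suc a) (f - t) V"
  shows "form_beyond n a (ind U) (ind V) = crossing e s f t + form_beyond n (Suc a) (ind U) (ind V)"
proof -
  have st: "s = 0 \<or> s = 1" "t = 0 \<or> t = 1" using e f by auto
  obtain e' f' where Suc: "e = Suc e'" "f = Suc f'" using e f by (metis Suc_le_D One_nat_def)
  \<comment> \<open>The comparisons of the faces of one triangle with a state depend only on these four positions.\<close>
  have pos: "c + 1 < x \<or> x = Suc c \<or> c = x \<or> x < c" for c x :: nat
    by auto
  have U1: "ind U (a, b, c) = of_bool (e \<le> c)" "ind V (a, b, c) = of_bool (f \<le> c)"
    if "a + b + c = n" for b c
    using U(1) V(1) that by (simp_all add: profile_def)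
  have U2: "ind U (a + 1, b, c) = of_bool (e - s \<le> c)" "ind V (a + 1, b, c) = of_bool (f - t \<le> c)"
    if "a + 1 + b + c = n" for b c
    using U(2) V(2) that by (simp_all add: profile_def)
  have w: "white_form (ind U) (ind V) (a, m - c, c)
      = (if c = e - 1 then of_bool (e = f) * (of_nat s - of_nat t) / 2 else 0)" if "c \<le> m" for c
  proof -
    have eq: "white_form (ind U) (ind V) (a, m - c, c)
      = (of_bool (e - s \<le> c) * (of_bool (f \<le> c + 1) - of_bool (f \<le> c))
         + of_bool (e \<le> c + 1) * (of_bool (f \<le> c) - of_bool (f - t \<le> c))
         + of_bool (e \<le> c) * (of_bool (f - t \<le> c) - of_bool (f \<le> c + 1))) / 2"
      using n that by (simp only: white_form.simps triangle_form_def U1 U2)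
    show ?thesis
      unfolding eq Suc using st pos[of c e'] pos[of c f']
      by (elim disjE) (simp_all add: of_bool_def)
  qed
  have b: "black_form (ind U) (ind V) (a, m - Suc c, c) =
       (if c = e - 1 then of_bool (f = e + 1 \<and> s = 0 \<and> t = 1) / 2 else 0)
       + (if c = f - 1 then - (of_bool (e = f + 1 \<and> s = 1 \<and> t = 0) / 2) else 0)"
    if "c < m" for c
  proof -
    have eq: "black_form (ind U) (ind V) (a, m - Suc c, c)
      = (of_bool (e - s \<le> c + 1) * (of_bool (f - t \<le> c) - of_bool (f \<le> c + 1))
         + of_bool (e - s \<le> c) * (of_bool (f \<le> c + 1) - of_bool (f - t \<le> c + 1))
         + of_bool (e \<le> c + 1) * (of_bool (f - t \<le> c + 1) - of_bool (f - t \<le> c))) / 2"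
      using n that by (simp only: black_form.simps triangle_form_def U1 U2)
    show ?thesis
      unfolding eq Suc using st pos[of c e'] pos[of c f']
      by (elim disjE) (simp_all add: of_bool_def)
  qed
  have "(\<Sum>c\<le>m. white_form (ind U) (ind V) (a, m - c, c))
      = (\<Sum>c\<le>m. if c = e - 1 then of_bool (e = f) * (of_nat s - of_nat t) / 2 else 0)"
    by (intro sum.cong refl w) simp
  also have "\<dots> = of_bool (e = f) * (of_nat s - of_nat t) / 2"
    using e by (subst sum.delta) auto
  finally have W: "(\<Sum>c\<le>m. white_form (ind U) (ind V) (a, m - c, c))
      = of_bool (e = f) * (of_nat s - of_nat t) / 2" .
  have "(\<Sum>c<m. black_form (ind U) (ind V) (a, m - Suc c, c))
      = (\<Sum>c<m. if c = e - 1 then of_bool (f = e + 1 \<and> s = 0 \<and> t = 1) / 2 else 0)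
        + (\<Sum>c<m. if c = f - 1 then - (of_bool (e = f + 1 \<and> s = 1 \<and> t = 0) / 2) else 0)"
    unfolding sum.distrib[symmetric] by (intro sum.cong refl b) simp
  also have "\<dots> = of_bool (f = e + 1 \<and> s = 0 \<and> t = 1) / 2 - of_bool (e = f + 1 \<and> s = 1 \<and> t = 0) / 2"
    using e f by (subst (1 2) sum.delta) auto
  finally have B: "(\<Sum>c<m. black_form (ind U) (ind V) (a, m - Suc c, c))
      = of_bool (f = e + 1 \<and> s = 0 \<and> t = 1) / 2 - of_bool (e = f + 1 \<and> s = 1 \<and> t = 0) / 2" .
  show ?thesis
    unfolding form_beyond_step[OF n] W B by (auto simp: crossing_def)
qed

section \<open>Paths as sequences of states\<close>

text \<open>The vertex that a path in state \<open>e\<close> enters when it crosses the line \<open>n - m\<close>; the two extreme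
  states stand for the sinks where a path ends that leaves the network just before that line.\<close>

definition node :: "nat \<Rightarrow> nat \<Rightarrow> nat \<Rightarrow> vertex" where
  "node n m e = (if e = 0 then BottomSink (m + 1) else if e = m + 1 then LeftSink (n - m)
                 else White (n - m) (m - e) (e - 1))"

definition hop :: "nat \<Rightarrow> nat \<Rightarrow> nat \<Rightarrow> nat \<Rightarrow> (vertex \<times> vertex) awalk" where
  "hop n m e e' =
     (if e' = 0 \<or> e' = m + 1 then [(node n (Suc m) e, node n m e')]
      else [(node n (Suc m) e, Black (n - Suc m) (m - e') (e' - 1)),
            (Black (n - Suc m) (m - e') (e' - 1), node n m e')])"

definition line :: "nat \<Rightarrow> nat \<Rightarrow> nat \<Rightarrow> face set" where
  "line n a e = {(a', b, c). a' = a \<and> a + b + c = n \<and> e \<le> c}"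

type_synonym route = "(vertex \<times> vertex) awalk \<times> face set"

text \<open>Sinks are numbered along the boundary, from \<open>1\<close> to \<open>n\<close> on the left side and from \<open>n + 1\<close> to \<open>2n\<close> on
  the bottom side.  A path that has left at the bottom has everything beyond the line \<open>n - m\<close> on its
  right, a path that has left at the left side has nothing.\<close>

definition exit_routes :: "nat \<Rightarrow> nat \<Rightarrow> nat \<Rightarrow> nat \<Rightarrow> route list" where
  "exit_routes n m e r =
     (if e = 0 \<and> r = n + m + 1 then [([], cells n 0 (n - m))]
      else if e = m + 1 \<and> r = n - m then [([], {})] else [])"

definition extend :: "nat \<Rightarrow> nat \<Rightarrow> nat \<Rightarrow> nat \<Rightarrow> route \<Rightarrow> route" where
  "extend n m e e' x = (hop n m e e' @ fst x, line n (n - Suc m) e \<union> snd x)"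

text \<open>All paths from \<open>node n m e\<close> to the sink with number \<open>r\<close>, each with the part of its right region on
  or beyond the line \<open>n - m\<close>.\<close>

primrec routes :: "nat \<Rightarrow> nat \<Rightarrow> nat \<Rightarrow> nat \<Rightarrow> route list" where
  "routes n 0 e r = exit_routes n 0 e r"
| "routes n (Suc m) e r =
     (if 1 \<le> e \<and> e \<le> Suc m
      then map (extend n m e e) (routes n m e r) @ map (extend n m e (e - 1)) (routes n m (e - 1) r)
      else exit_routes n (Suc m) e r)"

lemma routes_exit: "e = 0 \<or> m < e \<Longrightarrow> routes n m e r = exit_routes n m e r"
  by (cases m) auto

lemma routes_bottom: "routes n m 0 r = (if r = n + m + 1 then [([], cells n 0 (n - m))] else [])"
  by (auto simp: routes_exit exit_routes_def)

lemma routes_left: "routes n m (Suc m) r = (if r = n - m then [([], {})] else [])"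
  by (auto simp: routes_exit exit_routes_def)

text \<open>The two extreme sinks beyond the line \<open>n - m\<close> are reached only by paths that exit there.\<close>

lemma routes_sink_bounds:
  assumes "m \<le> n" "routes n m e r \<noteq> []"
  shows "n - m \<le> r \<and> r \<le> n + m + 1 \<and> (r = n - m \<longrightarrow> e = m + 1) \<and> (r = n + m + 1 \<longrightarrow> e = 0) \<and> e \<le> m + 1"
  using assms
proof (induction m arbitrary: e)
  case 0
  then show ?case by (auto simp: exit_routes_def split: if_splits)
next
  case (Suc m)
  show ?case
  proof (cases "1 \<le> e \<and> e \<le> Suc m")
    case True
    then obtain e' where "routes n m e' r \<noteq> []" using Suc.prems(2) by fastforce
    then have "n - m \<le> r" "r \<le> n + m + 1" using Suc.IH Suc.prems(1) by auto
    then show ?thesis using Suc.prems(1) True by linarith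
  next
    case False
    then show ?thesis using Suc.prems by (auto simp: exit_routes_def split: if_splits)
  qed
qed

lemma routes_profile:
  assumes "m \<le> n" "x \<in> set (routes n m e r)"
  shows "snd x \<subseteq> cells n 0 (n - m)" "profile n (n - m) e (snd x)"
proof -
  have "snd x \<subseteq> cells n 0 (n - m) \<and> profile n (n - m) e (snd x)"
    using assms
  proof (induction m arbitrary: e x)
    case 0
    then show ?case by (auto simp: exit_routes_def profile_def cells_def split: if_splits)
  next
    case (Suc m)
    show ?case
    proof (cases "1 \<le> e \<and> e \<le> Suc m")
      case True
      then obtain e' y where y: "y \<in> set (routes n m e' r)" "snd x = line n (n - Suc m) e \<union> snd y"
        using Suc.prems(2) by (auto simp: extend_def)
      then have "snd y \<subseteq> cells n 0 (n - m)"
        using Suc.IH Suc.prems(1) by simp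
      then show ?thesis
        using Suc.prems(1) y(2) by (auto simp: cells_def line_def profile_def)
    next
      case False
      then show ?thesis using Suc.prems by (auto simp: exit_routes_def profile_def cells_def split:
          if_splits)
    qed
  qed
  then show "snd x \<subseteq> cells n 0 (n - m)" "profile n (n - m) e (snd x)" by auto
qed

section \<open>Products of path sums\<close>

definition face_vec :: "face set \<Rightarrow> qvec" where
  "face_vec U = (\<Sum>\<alpha>\<in>U. Poly_Mapping.single \<alpha> 1)"

lemma lookup_face_vec: "finite U \<Longrightarrow> Poly_Mapping.lookup (face_vec U) \<alpha> = ind U \<alpha>"
  by (simp add: face_vec_def lookup_sum lookup_single when_def of_bool_def)

lemma finite_line [simp]: "finite (line n a e)"
proof -
  have "line n a e \<subseteq> cells n 0 0" by (auto simp: line_def cells_def)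
  then show ?thesis by (rule finite_subset) simp
qed

definition pair_term :: "nat \<Rightarrow> (rat \<Rightarrow> 'k::field) \<Rightarrow> rat \<Rightarrow> nat \<Rightarrow> face set \<Rightarrow> face set \<Rightarrow> 'k qtorus" where
  "pair_term n qp \<epsilon> a U V =
     Poly_Mapping.single (face_vec U + face_vec V) (qp (\<epsilon> * form_beyond n a (ind U) (ind V)))"

text \<open>For \<open>\<epsilon> = -1\<close> and \<open>m = n\<close> this is the product of two sums of path weights in the quantum torus, and
  for \<open>\<epsilon> = 1\<close> the product in the opposite order; for \<open>m < n\<close> it is the product in the quantum torus of
  the array beyond the line \<open>n - m\<close>.  All powers of \<open>q\<close> being explicit, relations among these sums can
  be checked in the commutative ring of finitely supported functions, with its untwisted product.\<close>

definition pair_sum :: "nat \<Rightarrow> (rat \<Rightarrow> 'k::field) \<Rightarrow> rat \<Rightarrow> nat \<Rightarrow> nat \<Rightarrow> nat \<Rightarrow> nat \<Rightarrow> nat \<Rightarrow> 'k qtorus" where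
  "pair_sum n qp \<epsilon> m e f r r' =
     (\<Sum>x\<leftarrow>routes n m e r. \<Sum>y\<leftarrow>routes n m f r'. pair_term n qp \<epsilon> (n - m) (snd x) (snd y))"

lemma sum_list_swap: "(\<Sum>x\<leftarrow>xs. \<Sum>y\<leftarrow>ys. h x y) = (\<Sum>y\<leftarrow>ys. \<Sum>x\<leftarrow>xs. h x y :: 'a::comm_monoid_add)"
  by (induction xs) (simp_all add: sum_list_addf)

text \<open>Antisymmetry of the form: exchanging the two factors inverts \<open>q\<close>.\<close>

lemma pair_sum_swap: "pair_sum n qp \<epsilon> m e f r r' = pair_sum n qp (- \<epsilon>) m f e r' r"
proof -
  have "pair_term n qp \<epsilon> a U V = pair_term n qp (- \<epsilon>) a V U" for a U V
    using form_beyond_antisym[of n a "ind V" "ind U"] by (simp add: pair_term_def add.commute)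
  then show ?thesis
    unfolding pair_sum_def by (subst sum_list_swap) simp
qed

locale q_powers =
  fixes qp :: "rat \<Rightarrow> 'k::field"
  assumes qp_0: "qp 0 = 1" and qp_add: "qp (r + s) = qp r * qp s"
begin

definition q_pow :: "rat \<Rightarrow> 'k qtorus" where
  "q_pow r = Poly_Mapping.single 0 (qp r)"

lemma q_pow_0 [simp]: "q_pow 0 = 1"
  by (simp add: q_pow_def qp_0)

lemma q_pow_add: "q_pow (r + s) = q_pow r * q_pow s"
  by (simp add: q_pow_def qp_add mult_single)

text \<open>The form splits into the contribution of the strip and the form beyond it, which does not see
  the line that was added.\<close>

lemma pair_term_step:
  assumes m: "Suc m \<le> n" and e: "1 \<le> e" "e \<le> Suc m" "s \<le> 1" and f: "1 \<le> f" "f \<le> Suc m" "t \<le> 1"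
    and x: "x \<in> set (routes n m (e - s) r)" and y: "y \<in> set (routes n m (f - t) r')"
  shows "pair_term n qp \<epsilon> (n - Suc m) (line n (n - Suc m) e \<union> snd x) (line n (n - Suc m) f \<union> snd y)
    = Poly_Mapping.single (face_vec (line n (n - Suc m) e) + face_vec (line n (n - Suc m) f)) 1
      * (q_pow (\<epsilon> * crossing e s f t) * pair_term n qp \<epsilon> (n - m) (snd x) (snd y))"
proof -
  let ?a = "n - Suc m"
  have a: "?a + Suc m = n" and Sa: "Suc ?a = n - m" using m by auto
  have xs: "snd x \<subseteq> cells n 0 (Suc ?a)" "profile n (Suc ?a) (e - s) (snd x)"
    and ys: "snd y \<subseteq> cells n 0 (Suc ?a)" "profile n (Suc ?a) (f - t) (snd y)"
    unfolding Sa using m routes_profile[OF _ x] routes_profile[OF _ y] by auto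
  have vec: "face_vec (line n ?a g \<union> W) = face_vec (line n ?a g) + face_vec W"
    if "W \<subseteq> cells n 0 (Suc ?a)" for g W
  proof -
    have "finite W" using that by (rule finite_subset) simp
    moreover have "line n ?a g \<inter> W = {}" using that by (auto simp: line_def cells_def)
    ultimately show ?thesis by (simp add: face_vec_def sum.union_disjoint)
  qed
  have p: "profile n ?a g (line n ?a g \<union> W)" if "W \<subseteq> cells n 0 (Suc ?a)" for g W
    using that by (auto simp: profile_def line_def cells_def)
  have p': "profile n (Suc ?a) g' (line n ?a g \<union> W)" if "profile n (Suc ?a) g' W" for g g' W
    using that by (auto simp: profile_def line_def)
  have "form_beyond n ?a (ind (line n ?a e \<union> snd x)) (ind (line n ?a f \<union> snd y))
      = crossing e s f t + form_beyond n (Suc ?a) (ind (line n ?a e \<union> snd x)) (ind (line n ?a f \<union> snd y))"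
    by (rule form_beyond_crossing[OF a e f p[OF xs(1)] p'[OF xs(2)] p[OF ys(1)] p'[OF ys(2)]])
  also have "form_beyond n (Suc ?a) (ind (line n ?a e \<union> snd x)) (ind (line n ?a f \<union> snd y))
      = form_beyond n (Suc ?a) (ind (snd x)) (ind (snd y))"
    by (rule form_beyond_cong) (auto simp: line_def cells_def of_bool_def)
  finally have F: "form_beyond n ?a (ind (line n ?a e \<union> snd x)) (ind (line n ?a f \<union> snd y))
      = crossing e s f t + form_beyond n (n - m) (ind (snd x)) (ind (snd y))"
    unfolding Sa .
  show ?thesis
    unfolding pair_term_def F vec[OF xs(1)] vec[OF ys(1)]
    by (simp add: q_pow_def mult_single distrib_left qp_add ac_simps)
qed

text \<open>Each of the two paths has two ways to cross the strip.\<close>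

lemma pair_sum_step:
  assumes m: "Suc m \<le> n" and e: "1 \<le> e" "e \<le> Suc m" and f: "1 \<le> f" "f \<le> Suc m"
  shows "pair_sum n qp \<epsilon> (Suc m) e f r r'
    = Poly_Mapping.single (face_vec (line n (n - Suc m) e) + face_vec (line n (n - Suc m) f)) 1
      * (q_pow (\<epsilon> * crossing e 0 f 0) * pair_sum n qp \<epsilon> m e f r r'
       + q_pow (\<epsilon> * crossing e 0 f 1) * pair_sum n qp \<epsilon> m e (f - 1) r r'
       + q_pow (\<epsilon> * crossing e 1 f 0) * pair_sum n qp \<epsilon> m (e - 1) f r r'
       + q_pow (\<epsilon> * crossing e 1 f 1) * pair_sum n qp \<epsilon> m (e - 1) (f - 1) r r')"
proof -
  let ?a = "n - Suc m"
  let ?K = "Poly_Mapping.single (face_vec (line n ?a e) + face_vec (line n ?a f)) (1::'k)"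
  have quarter: "(\<Sum>x\<leftarrow>routes n m (e - s) r. \<Sum>y\<leftarrow>routes n m (f - t) r'.
        pair_term n qp \<epsilon> ?a (line n ?a e \<union> snd x) (line n ?a f \<union> snd y))
      = ?K * (q_pow (\<epsilon> * crossing e s f t) * pair_sum n qp \<epsilon> m (e - s) (f - t) r r')"
    if "s \<le> 1" "t \<le> 1" for s t
  proof -
    have "(\<Sum>x\<leftarrow>routes n m (e - s) r. \<Sum>y\<leftarrow>routes n m (f - t) r'.
        pair_term n qp \<epsilon> ?a (line n ?a e \<union> snd x) (line n ?a f \<union> snd y))
      = (\<Sum>x\<leftarrow>routes n m (e - s) r. \<Sum>y\<leftarrow>routes n m (f - t) r'.
        ?K * (q_pow (\<epsilon> * crossing e s f t) * pair_term n qp \<epsilon> (n - m) (snd x) (snd y)))"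
      using assms that by (intro arg_cong[where f = sum_list] map_cong refl pair_term_step) auto
    then show ?thesis by (simp add: pair_sum_def sum_list_const_mult)
  qed
  show ?thesis
    unfolding pair_sum_def[of _ _ _ "Suc m"]
    using assms quarter[of 0 0] quarter[of 0 1] quarter[of 1 0] quarter[of 1 1]
    by (simp add: extend_def comp_def sum_list_addf distrib_left add.assoc)
qed

lemma pair_sum_empty:
  "routes n m e r = [] \<or> routes n m f r' = [] \<Longrightarrow> pair_sum n qp \<epsilon> m e f r r' = 0"
  by (auto simp: pair_sum_def)

text \<open>If one of the paths has left the network, its remaining region is empty or full, so the form
  vanishes and the two factors commute.\<close>

lemma pair_sum_exit:
  assumes "e = 0 \<or> m < e \<or> f = 0 \<or> m < f"
  shows "pair_sum n qp \<epsilon> m e f r r' = pair_sum n qp \<epsilon>' m e f r r'"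
proof -
  have 1: "pair_term n qp \<epsilon> (n - m) (snd x) V = pair_term n qp \<epsilon>' (n - m) (snd x) V"
    if "x \<in> set (exit_routes n m g t)" for x V \<epsilon> \<epsilon>' g t
  proof -
    have "form_beyond n (n - m) (ind (snd x)) (ind V) = 0"
      using that by (intro form_beyond_const[where k = "of_bool (g = 0)"]) (auto simp:
          exit_routes_def split: if_splits)
    then show ?thesis by (simp add: pair_term_def)
  qed
  have 2: "pair_term n qp \<epsilon> (n - m) V (snd x) = pair_term n qp \<epsilon>' (n - m) V (snd x)"
    if "x \<in> set (exit_routes n m g t)" for x V \<epsilon> \<epsilon>' g t
  proof -
    have "form_beyond n (n - m) (ind V) (ind (snd x)) = 0"
      using that by (intro form_beyond_const_right[where k = "of_bool (g = 0)"]) (auto simp: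
          exit_routes_def split: if_splits)
    then show ?thesis by (simp add: pair_term_def)
  qed
  show ?thesis
    unfolding pair_sum_def using assms
    by (intro arg_cong[where f = sum_list] map_cong refl) (metis 1 2 routes_exit)
qed

section \<open>Exchange relations\<close>

lemma crossing_simps:
  "crossing e 0 e 0 = 0" "crossing e (Suc 0) e (Suc 0) = 0"
  "crossing e 0 e (Suc 0) = - (1 / 2)" "crossing e (Suc 0) e 0 = 1 / 2"
  "e \<noteq> f \<Longrightarrow> crossing e 0 f 0 = 0" "e \<noteq> f \<Longrightarrow> crossing e (Suc 0) f (Suc 0) = 0"
  "e \<noteq> f \<Longrightarrow> crossing e 0 f (Suc 0) = of_bool (f = Suc e) / 2"
  "e \<noteq> f \<Longrightarrow> crossing e (Suc 0) f 0 = - of_bool (e = Suc f) / 2"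
  by (auto simp: crossing_def)

lemma q_pow_half: "q_pow (1/2) * q_pow (1/2) = q_pow 1" "q_pow (- (1/2)) * q_pow (- (1/2)) = q_pow (- 1)"
  "q_pow (1/2) * q_pow (- (1/2)) = 1" "q_pow (- (1/2)) * q_pow (1/2) = 1"
  by (simp_all flip: q_pow_add)

text \<open>At an exit both products agree, and the remaining terms vanish: of the sinks still within reach,
  leaving at the left side leads to the one with the smallest number, and leaving at the bottom to
  the one with the largest.\<close>

lemma pair_sum_exchange_exit:
  assumes m: "m \<le> n" and r: "r < r'" and ef: "e = 0 \<or> m < e \<or> f = 0 \<or> m < f"
  shows "pair_sum n qp (- 1) m e f r r' =
    q_pow (of_bool (e = f)) * pair_sum n qp 1 m e f r r'
    + of_bool (f < e) * (q_pow 1 - q_pow (- 1)) * pair_sum n qp 1 m f e r r'"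
proof -
  have 1: "routes n m e r = [] \<or> routes n m f r' = []" if "e = f"
  proof (rule ccontr)
    assume "\<not> ?thesis"
    then have "routes n m e r \<noteq> []" "routes n m e r' \<noteq> []" using that by auto
    then show False
      using r ef that m by (auto simp: routes_exit exit_routes_def split: if_splits)
  qed
  have 2: "routes n m f r = [] \<or> routes n m e r' = []" if "f < e"
  proof (rule ccontr)
    assume "\<not> ?thesis"
    then have "routes n m f r \<noteq> []" "routes n m e r' \<noteq> []" by auto
    with routes_sink_bounds[OF m, of f r] routes_sink_bounds[OF m, of e r']
    have "n - m \<le> r" "r' \<le> n + m + 1" "r = n - m \<longrightarrow> f = m + 1" "r' = n - m \<longrightarrow> e = m + 1"
      "r = n + m + 1 \<longrightarrow> f = 0" "e \<le> m + 1" by auto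
    moreover have "e = m + 1 \<Longrightarrow> r' = n - m" "f = 0 \<Longrightarrow> r = n + m + 1"
      using \<open>routes n m f r \<noteq> []\<close> \<open>routes n m e r' \<noteq> []\<close>
      by (auto simp: routes_bottom routes_left split: if_splits)
    ultimately show False
      using ef \<open>f < e\<close> r by linarith
  qed
  have "pair_sum n qp (- 1) m e f r r' = pair_sum n qp 1 m e f r r'"
    by (rule pair_sum_exit[OF ef])
  moreover have "q_pow (of_bool (e = f)) * pair_sum n qp 1 m e f r r' = pair_sum n qp 1 m e f r r'"
    using 1 by (cases "e = f") (auto simp: pair_sum_empty)
  moreover have "of_bool (f < e) * (q_pow 1 - q_pow (- 1)) * pair_sum n qp 1 m f e r r' = 0"
    using 2 by (cases "f < e") (auto simp: pair_sum_empty)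
  ultimately show ?thesis by simp
qed

text \<open>By induction on the number of remaining lines.  In the step, only pairs of states that coincide
  or are adjacent receive a factor \<open>q\<^bsup>\<plusminus>1/2\<^esup>\<close>, and these factors turn the relation for equal states
  into the one for adjacent states and conversely.\<close>

lemma pair_sum_exchange:
  assumes "m \<le> n" "r < r'"
  shows "pair_sum n qp (- 1) m e f r r' =
    q_pow (of_bool (e = f)) * pair_sum n qp 1 m e f r r'
    + of_bool (f < e) * (q_pow 1 - q_pow (- 1)) * pair_sum n qp 1 m f e r r'"
  using assms(1)
proof (induction m arbitrary: e f)
  case 0
  then show ?case using assms(2) by (intro pair_sum_exchange_exit) auto
next
  case (Suc m)
  show ?case
  proof (cases "e = 0 \<or> Suc m < e \<or> f = 0 \<or> Suc m < f")
    case True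
    then show ?thesis using pair_sum_exchange_exit[OF Suc.prems assms(2)] by blast
  next
    case False
    then have ef: "1 \<le> e" "e \<le> Suc m" "1 \<le> f" "f \<le> Suc m" by auto
    define X where "X = (\<lambda>e f. pair_sum n qp (- 1) m e f r r')"
    define Y where "Y = (\<lambda>e f. pair_sum n qp 1 m e f r r')"
    define h where "h = q_pow (1/2)"
    define k where "k = q_pow (- (1/2))"
    define K where "K = (\<lambda>e f. Poly_Mapping.single
      (face_vec (line n (n - Suc m) e) + face_vec (line n (n - Suc m) f)) (1::'k))"
    have hk: "h * k = 1" and q: "q_pow 1 = h * h" "q_pow (- 1) = k * k"
      by (simp_all add: h_def k_def q_pow_half)
    have Kc: "K e f = K f e" for e f by (simp add: K_def add.commute)
    have stepX: "pair_sum n qp (- 1) (Suc m) e f r r'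
      = K e f * (q_pow (- crossing e 0 f 0) * X e f + q_pow (- crossing e 0 f 1) * X e (f - 1)
         + q_pow (- crossing e 1 f 0) * X (e - 1) f + q_pow (- crossing e 1 f 1) * X (e - 1) (f - 1))"
      unfolding K_def X_def using pair_sum_step[OF Suc.prems ef, where \<epsilon> = "- 1"] by simp
    have stepY: "pair_sum n qp 1 (Suc m) e f r r'
      = K e f * (q_pow (crossing e 0 f 0) * Y e f + q_pow (crossing e 0 f 1) * Y e (f - 1)
         + q_pow (crossing e 1 f 0) * Y (e - 1) f + q_pow (crossing e 1 f 1) * Y (e - 1) (f - 1))"
      if "1 \<le> e" "e \<le> Suc m" "1 \<le> f" "f \<le> Suc m" for e f
      unfolding K_def Y_def using pair_sum_step[OF Suc.prems that, where \<epsilon> = 1] by simp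
    have XY: "X e f = q_pow (of_bool (e = f)) * Y e f + of_bool (f < e) * (q_pow 1 - q_pow (- 1)) *
        Y f e" for e f
      unfolding X_def Y_def using Suc.prems by (intro Suc.IH) simp
    have X_eq: "X i i = h * h * Y i i" for i
      by (simp add: XY q)
    have X_lt: "X i j = Y i j" if "i < j" for i j
      using that by (simp add: XY)
    have X_gt: "X i j = Y i j + (h * h - k * k) * Y j i" if "j < i" for i j
      using that by (simp add: XY q)
    have hhk: "h * (k * z) = z" "k * (h * z) = z" for z
      using hk by (simp_all add: mult.commute[of k h] flip: mult.assoc)
    note steps = stepX stepY[OF ef] stepY[OF ef(3,4,1,2)] Kc[of f e]
    note simps = crossing_simps q X_eq X_lt X_gt
    note ring = hk hhk distrib_left distrib_right right_diff_distrib left_diff_distrib ac_simps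
    consider "e = f" | "f = e + 1" | "e + 1 < f" | "e = f + 1" | "f + 1 < e" by linarith
    then show ?thesis
    proof cases
      case 1
      then show ?thesis
        using ef unfolding steps unfolding 1 by (simp add: simps ring flip: h_def k_def)
    next
      case 2
      then show ?thesis
        using ef unfolding steps by (simp add: simps ring flip: h_def k_def)
    next
      case 3
      then show ?thesis
        using ef unfolding steps by (simp add: simps ring flip: h_def k_def)
    next
      case 4
      then show ?thesis
        using ef unfolding steps by (simp add: simps ring flip: h_def k_def)
    next
      case 5
      then show ?thesis
        using ef unfolding steps by (simp add: simps ring flip: h_def k_def)
    qed
  qed
qed

lemma pair_sum_same_sink_exit:
  assumes m: "m \<le> n" and ef: "e = 0 \<or> m < e \<or> f = 0 \<or> m < f" and fe: "f < e"
  shows "pair_sum n qp (- 1) m e f r r = q_pow 1 * pair_sum n qp (- 1) m f e r r"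
proof -
  have "routes n m e r = [] \<or> routes n m f r = []"
  proof (rule ccontr)
    assume "\<not> ?thesis"
    then have "routes n m f r \<noteq> []" "routes n m e r \<noteq> []" by auto
    with routes_sink_bounds[OF m, of f r] routes_sink_bounds[OF m, of e r]
    have "r = n - m \<longrightarrow> f = m + 1" "r = n + m + 1 \<longrightarrow> e = 0" "e \<le> m + 1" by auto
    moreover have "e = m + 1 \<Longrightarrow> r = n - m" "f = 0 \<Longrightarrow> r = n + m + 1"
      using \<open>routes n m f r \<noteq> []\<close> \<open>routes n m e r \<noteq> []\<close>
      by (auto simp: routes_bottom routes_left split: if_splits)
    ultimately show False
      using ef fe by linarith
  qed
  then show ?thesis by (auto simp: pair_sum_empty)
qed

text \<open>For a common sink the two products are related by \<open>pair_sum_swap\<close>, so the exchange relation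
  becomes a \<open>q\<close>-commutation; it propagates for the same reason as in \<open>pair_sum_exchange\<close>.\<close>

lemma pair_sum_same_sink:
  assumes "m \<le> n" "f < e"
  shows "pair_sum n qp (- 1) m e f r r = q_pow 1 * pair_sum n qp (- 1) m f e r r"
  using assms
proof (induction m arbitrary: e f)
  case 0
  then show ?case by (intro pair_sum_same_sink_exit) auto
next
  case (Suc m)
  show ?case
  proof (cases "e = 0 \<or> Suc m < e \<or> f = 0 \<or> Suc m < f")
    case True
    then show ?thesis using pair_sum_same_sink_exit[OF Suc.prems(1) _ Suc.prems(2)] by blast
  next
    case False
    then have ef: "1 \<le> e" "e \<le> Suc m" "1 \<le> f" "f \<le> Suc m" by auto
    define X where "X = (\<lambda>e f. pair_sum n qp (- 1) m e f r r)"
    define K where "K = (\<lambda>e f. Poly_Mapping.single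
      (face_vec (line n (n - Suc m) e) + face_vec (line n (n - Suc m) f)) (1::'k))"
    have Kc: "K e f = K f e" for e f by (simp add: K_def add.commute)
    have step: "pair_sum n qp (- 1) (Suc m) e f r r
    = K e f * (q_pow (- crossing e 0 f 0) * X e f + q_pow (- crossing e 0 f 1) * X e (f - 1)
       + q_pow (- crossing e 1 f 0) * X (e - 1) f + q_pow (- crossing e 1 f 1) * X (e - 1) (f - 1))"
      if "1 \<le> e" "e \<le> Suc m" "1 \<le> f" "f \<le> Suc m" for e f
      unfolding K_def X_def using pair_sum_step[OF Suc.prems(1) that, where \<epsilon> = "- 1" and r = r and
          r' = r] by simp
    have X: "X e f = q_pow 1 * X f e" if "f < e" for e f
      unfolding X_def using Suc.prems that by (intro Suc.IH) simp
    have h: "q_pow (1/2) = q_pow 1 * q_pow (- (1/2))" by (simp flip: q_pow_add)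
    have "X e f = q_pow 1 * X f e" "X e (f - 1) = q_pow 1 * X (f - 1) e" "X (e - 1) (f - 1) = q_pow
        1 * X (f - 1) (e - 1)"
      using Suc.prems ef by (auto intro!: X)
    moreover have "q_pow (- crossing e 1 f 0) * X (e - 1) f = q_pow 1 * (q_pow (- crossing f 0 e 1)
        * X f (e - 1))"
    proof (cases "e = f + 1")
      case True
      then show ?thesis by (simp add: crossing_simps h ac_simps)
    next
      case False
      then show ?thesis using Suc.prems by (subst X) (auto simp: crossing_simps)
    qed
    ultimately show ?thesis
      using Suc.prems unfolding step[OF ef] step[OF ef(3,4,1,2)] Kc[of f e]
      by (simp add: crossing_simps distrib_left ac_simps)
  qed
qed

text \<open>The entries of the \<open>R\<close>-matrix relation, with the rows indexed by sinks and the columns by states.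
  For \<open>r < r'\<close> it is the exchange relation and for \<open>r = r'\<close> the \<open>q\<close>-commutation; for \<open>r > r'\<close> it follows
  from the exchange relation applied to both orders of the two states.\<close>

lemma pair_sum_RTT:
  assumes "m \<le> n"
  shows "q_pow (of_bool (r = r')) * pair_sum n qp (- 1) m e f r r'
      + of_bool (r' < r) * (q_pow 1 - q_pow (- 1)) * pair_sum n qp (- 1) m e f r' r
    = q_pow (of_bool (e = f)) * pair_sum n qp (- 1) m f e r' r
      + of_bool (f < e) * (q_pow 1 - q_pow (- 1)) * pair_sum n qp (- 1) m e f r' r"
proof -
  have swap: "pair_sum n qp 1 m e f r r' = pair_sum n qp (- 1) m f e r' r" for e f r r'
    by (rule pair_sum_swap)
  have QQ: "q_pow (- 1) * (q_pow 1 * z) = z" "q_pow 1 * (q_pow (- 1) * z) = z" "q_pow 1 * q_pow (-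
      1) = 1" for z
    by (simp_all flip: mult.assoc q_pow_add)
  consider "r = r'" | "r < r'" | "r' < r" by linarith
  then show ?thesis
  proof cases
    case 1
    consider "e = f" | "f < e" | "e < f" by linarith
    then show ?thesis
    proof cases
      case 2
      show ?thesis using 1 2 pair_sum_same_sink[OF assms 2, of r]
        by (simp add: left_diff_distrib right_diff_distrib mult.assoc QQ)
    next
      case 3
      show ?thesis using 1 3 pair_sum_same_sink[OF assms 3, of r]
        by simp
    qed (use 1 in simp)
  next
    case 2
    then show ?thesis using pair_sum_exchange[OF assms 2, of e f] by (simp add: swap)
  next
    case 3
    define a where "a = pair_sum n qp 1 m e f r' r"
    define b where "b = pair_sum n qp 1 m f e r' r"
    have 1: "pair_sum n qp (- 1) m e f r r' = b"
      unfolding b_def by (subst pair_sum_swap) simp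
    have 2: "pair_sum n qp (- 1) m e f r' r = q_pow (of_bool (e = f)) * a + of_bool (f < e) * (q_pow
        1 - q_pow (- 1)) * b"
      unfolding a_def b_def by (rule pair_sum_exchange[OF assms 3])
    have 4: "pair_sum n qp (- 1) m f e r' r = q_pow (of_bool (f = e)) * b + of_bool (e < f) * (q_pow
        1 - q_pow (- 1)) * a"
      unfolding a_def b_def by (rule pair_sum_exchange[OF assms 3])
    have "e = f \<Longrightarrow> a = b" by (simp add: a_def b_def)
    then show ?thesis
      using 3 unfolding 1 2 4
      by (cases e f rule: linorder_cases) (simp_all add: algebra_simps QQ)
  qed
qed

end

section \<open>Paths of the network\<close>

definition sink :: "nat \<Rightarrow> nat \<Rightarrow> vertex" where
  "sink n r = (if r \<le> n then LeftSink r else BottomSink (r - n))"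

lemma arcs_network: "(u, v) \<in> arcs (network n) \<longleftrightarrow> (\<exists>\<alpha> \<beta>. net_arc n u v \<alpha> \<beta>)"
  by (simp add: network_def)

lemma tail_head_network [simp]: "tail (network n) = fst" "head (network n) = snd"
  by (simp_all add: network_def)

lemma arcs_networkI: "net_arc n u v \<alpha> \<beta> \<Longrightarrow> (u, v) \<in> arcs (network n)"
  unfolding arcs_network by blast

lemma net_arc_faces: "net_arc n u v \<alpha> \<beta> \<Longrightarrow> \<alpha> \<in> faces n \<and> \<beta> \<in> faces n"
  by (erule net_arc.cases) (auto simp: faces_def)

lemma arc_from_white:
  assumes "(White a b c, v) \<in> arcs (network n)"
  shows "(b \<noteq> 0 \<and> v = Black a (b - 1) c) \<or> (c \<noteq> 0 \<and> v = Black a b (c - 1))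
    \<or> (b = 0 \<and> v = LeftSink (a + 1)) \<or> (c = 0 \<and> v = BottomSink (b + 1))"
  using assms unfolding arcs_network by (elim exE) (erule net_arc.cases, auto)

lemma arc_from_black: "(Black a b c, v) \<in> arcs (network n) \<Longrightarrow> v = White (a + 1) b c"
  unfolding arcs_network by (elim exE) (erule net_arc.cases, auto)

lemma no_arc_from_sink: "(sink n r, v) \<notin> arcs (network n)"
  unfolding arcs_network by (auto simp: sink_def elim: net_arc.cases)

lemma network_awalk_Nil: "pre_digraph.awalk (network n) u [] v \<longleftrightarrow> u = v \<and> u \<in> verts (network n)"
  by (auto simp: pre_digraph.awalk_def pre_digraph.cas.simps)

lemma network_awalk_Cons:
  "pre_digraph.awalk (network n) u (x # p) v
     \<longleftrightarrow> (\<exists>w. x = (u, w) \<and> (u, w) \<in> arcs (network n) \<and> pre_digraph.awalk (network n) w p v)"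
proof -
  interpret fin_digraph "network n" by (rule fin_digraph_network)
  show ?thesis
    by (cases x) (auto simp: awalk_Cons_iff)
qed

lemma hop_is_walk:
  assumes "Suc m \<le> n" "1 \<le> e" "e \<le> Suc m" "e' = e \<or> e' = e - 1"
    and "pre_digraph.awalk (network n) (node n m e') p v"
  shows "pre_digraph.awalk (network n) (node n (Suc m) e) (hop n m e e' @ p) v"
proof -
  have arc1: "(White a (Suc b) c, Black a b c) \<in> arcs (network n)" if "a + (b+1) + c + 1 = n" for a b c
    using arcs_networkI[OF white_black_b[OF that]] by simp
  have arc2: "(White a b (Suc c), Black a b c) \<in> arcs (network n)" if "a + b + (c+1) + 1 = n" for a b c
    using arcs_networkI[OF white_black_c[OF that]] by simp
  have arc3: "(Black a b c, White (Suc a) b c) \<in> arcs (network n)" if "a + b + c + 2 = n" for a b c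
    using arcs_networkI[OF black_white[OF that]] by simp
  have arc4: "(White a 0 c, LeftSink (Suc a)) \<in> arcs (network n)" if "a + c + 1 = n" for a c
    using arcs_networkI[OF left_sink[of "Suc a" n]] that by auto
  have arc5: "(White a b 0, BottomSink (Suc b)) \<in> arcs (network n)" if "a + b + 1 = n" for a b
    using arcs_networkI[OF bottom_sink[of "Suc b" n]] that by auto
  define a where "a = n - Suc m"
  have a: "n - m = Suc a" "a + Suc m = n" using assms(1) by (auto simp: a_def)
  consider "e' = 0" "e = 1" | "e' = m + 1" "e = m + 1" | "e' = e" "e \<le> m" | c' where "e' = Suc c'"
      "e = Suc (Suc c')" "e' \<le> m"
    using assms(2,3,4) by (cases "e = 1"; cases "e = m + 1"; cases e; cases "e - 1") auto
  then show ?thesis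
  proof cases
    case 1
    then show ?thesis using assms(5) arc5[of a m] a
      by (auto simp: hop_def node_def network_awalk_Cons simp flip: a_def)
  next
    case 2
    then show ?thesis using assms(5) arc4[of a m] a
      by (auto simp: hop_def node_def network_awalk_Cons simp flip: a_def)
  next
    case 3
    then show ?thesis using assms(2,5) arc1[of a "m - e" "e - 1"] arc3[of a "m - e" "e - 1"] a
      by (auto simp: hop_def node_def network_awalk_Cons Suc_diff_le simp flip: a_def)
  next
    case 4
    then show ?thesis using assms(5) arc2[of a "m - e'" "c'"] arc3[of a "m - e'" "c'"] a
      by (auto simp: hop_def node_def network_awalk_Cons simp flip: a_def)
  qed
qed

lemma node_sink: "m < n \<Longrightarrow> node n m 0 = sink n (n + m + 1)" "m < n \<Longrightarrow> node n m (Suc m) = sink n (n - m)"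
  by (auto simp: node_def sink_def)

lemma sink_inject: "r \<in> {1..2*n} \<Longrightarrow> r' \<in> {1..2*n} \<Longrightarrow> sink n r = sink n r' \<longleftrightarrow> r = r'"
  by (auto simp: sink_def)

lemma sink_vertex: "r \<in> {1..2*n} \<Longrightarrow> sink n r \<in> verts (network n)"
  by (auto simp: sink_def network_def inj_image_mem_iff inj_def)

lemma awalk_from_sink:
  "pre_digraph.awalk (network n) (sink n r) p v \<longleftrightarrow> p = [] \<and> v = sink n r \<and> sink n r \<in> verts (network n)"
  by (cases p) (auto simp: network_awalk_Nil network_awalk_Cons no_arc_from_sink)

text \<open>A white vertex leads to a sink or to a black vertex, and a black vertex leads only to the white
  vertex across the next line.\<close>

lemma walk_starts_with_hop:
  assumes "Suc m \<le> n" "1 \<le> e" "e \<le> Suc m"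
    and p: "pre_digraph.awalk (network n) (node n (Suc m) e) p (sink n r)"
  obtains e' q where "e' = e \<or> e' = e - 1" "p = hop n m e e' @ q"
    "pre_digraph.awalk (network n) (node n m e') q (sink n r)"
proof -
  note found = that
  define a where "a = n - Suc m"
  have a: "n - m = Suc a" "a + Suc m = n" using assms(1) by (auto simp: a_def)
  have u: "node n (Suc m) e = White a (Suc m - e) (e - 1)"
    using assms by (auto simp: node_def a_def)
  have ns: "sink n r \<noteq> White x y z" "sink n r \<noteq> Black x y z" for x y z
    by (auto simp: sink_def)
  obtain w q where w: "p = (node n (Suc m) e, w) # q" "(White a (Suc m - e) (e - 1), w) \<in> arcs (network n)"
    "pre_digraph.awalk (network n) w q (sink n r)"
    using p by (cases p) (auto simp: network_awalk_Nil network_awalk_Cons u ns ns[symmetric])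
  have black: thesis
    if B: "w = Black a (m - e') (e' - 1)" and e': "e' = e \<or> e' = e - 1" "e' \<noteq> 0" "e' \<noteq> m + 1" for e'
  proof -
    obtain q' y where q': "q = (w, y) # q'" "(w, y) \<in> arcs (network n)" "pre_digraph.awalk (network
        n) y q' (sink n r)"
      using w(3) by (cases q) (auto simp: network_awalk_Nil network_awalk_Cons B ns ns[symmetric])
    have "y = node n m e'"
      using arc_from_black[OF q'(2)[unfolded B]] e' a by (simp add: node_def)
    then show thesis
      using found[of e' q'] e' q' w(1) B by (simp add: hop_def a_def)
  qed
  from arc_from_white[OF w(2)] show thesis
  proof (elim disjE conjE, goal_cases)
    case 1
    then show thesis using black[of e] assms(2,3) by simp
  next
    case 2
    then show thesis using black[of "e - 1"] assms by (simp add: Suc_diff_le)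
  next
    case 3
    then have "e = m + 1" using assms by simp
    then show thesis using found[of e q] w 3 a by (simp add: hop_def node_def)
  next
    case 4
    then have "e = 1" using assms by simp
    then show thesis using found[of 0 q] w 4 a by (simp add: hop_def node_def)
  qed
qed

lemma awalk_iff_route:
  assumes "m \<le> n" "r \<in> {1..2*n}" "(1 \<le> e \<and> e \<le> m) \<or> (m < n \<and> e \<le> m + 1)"
  shows "pre_digraph.awalk (network n) (node n m e) p (sink n r) \<longleftrightarrow> p \<in> fst ` set (routes n m e r)"
  using assms
proof (induction m arbitrary: e p)
  have exit: "pre_digraph.awalk (network n) (node n m e) p (sink n r) \<longleftrightarrow> p \<in> fst ` set (routes n m e r)"
    if m: "m < n" and e: "e = 0 \<or> e = m + 1" for m e p
  proof -
    define r' where "r' = (if e = 0 then n + m + 1 else n - m)"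
    have r': "r' \<in> {1..2*n}" "node n m e = sink n r'" using m e by (auto simp: r'_def node_sink)
    have "pre_digraph.awalk (network n) (node n m e) p (sink n r) \<longleftrightarrow> p = [] \<and> r = r'"
      using sink_inject[OF assms(2) r'(1)] sink_vertex[OF r'(1)] by (auto simp: r'(2) awalk_from_sink)
    also have "\<dots> \<longleftrightarrow> p \<in> fst ` set (routes n m e r)"
      using e by (auto simp: r'_def routes_exit exit_routes_def)
    finally show ?thesis .
  qed
  {
    case 0
    then show ?case by (intro exit) auto
  next
    case (Suc m)
    show ?case
    proof (cases "1 \<le> e \<and> e \<le> Suc m")
      case False
      then show ?thesis using Suc.prems by (intro exit) auto
    next
      case True
      have IH: "pre_digraph.awalk (network n) (node n m e') q (sink n r) \<longleftrightarrow> q \<in> fst ` set (routes n m e' r)"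
        if "e' = e \<or> e' = e - 1" for e' q
        using that True Suc.prems by (intro Suc.IH) auto
      have "pre_digraph.awalk (network n) (node n (Suc m) e) p (sink n r)
        \<longleftrightarrow> (\<exists>e' q. (e' = e \<or> e' = e - 1) \<and> p = hop n m e e' @ q
              \<and> pre_digraph.awalk (network n) (node n m e') q (sink n r))"
        using hop_is_walk walk_starts_with_hop Suc.prems(1) True by metis
      also have "\<dots> \<longleftrightarrow> (\<exists>e' q. (e' = e \<or> e' = e - 1) \<and> p = hop n m e e' @ q \<and> q \<in> fst ` set (routes n
          m e' r))"
        by (intro ex_cong1 conj_cong refl IH)
      also have "fst ` set (routes n (Suc m) e r)
          = (\<Union>e'\<in>{e, e - 1}. (@) (hop n m e e') ` fst ` set (routes n m e' r))"
        using True by (simp add: extend_def image_Un image_image)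
      then have "(\<exists>e' q. (e' = e \<or> e' = e - 1) \<and> p = hop n m e e' @ q \<and> q \<in> fst ` set (routes n m e' r))
          \<longleftrightarrow> p \<in> fst ` set (routes n (Suc m) e r)"
        by blast
      finally show ?thesis .
    qed
  }
qed

lemma distinct_routes: "distinct (map fst (routes n m e r))"
proof (induction m arbitrary: e)
  case 0
  then show ?case by (simp add: exit_routes_def)
next
  case (Suc m)
  show ?case
  proof (cases "1 \<le> e \<and> e \<le> Suc m")
    case True
    have ext: "map fst (map (extend n m e e') xs) = map ((@) (hop n m e e')) (map fst xs)" for e' xs
      by (simp add: extend_def)
    have "hd (hop n m e e) \<noteq> hd (hop n m e (e - 1))" "hop n m e e \<noteq> []" "hop n m e (e - 1) \<noteq> []"
      using True by (auto simp: hop_def node_def)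
    then have "hop n m e e @ p \<noteq> hop n m e (e - 1) @ q" for p q
      by (metis hd_append2)
    then show ?thesis
      using True Suc.IH by (auto simp: ext distinct_map inj_on_def simp del: map_map)
  next
    case False
    then show ?thesis by (auto simp: exit_routes_def)
  qed
qed

text \<open>A potential that increases along every edge; so directed walks never repeat a vertex.\<close>

fun vertex_depth :: "nat \<Rightarrow> vertex \<Rightarrow> nat" where
  "vertex_depth n (Source i) = 0"
| "vertex_depth n (White a b c) = 2 * a + 1"
| "vertex_depth n (Black a b c) = 2 * a + 2"
| "vertex_depth n (LeftSink i) = 2 * n + 1"
| "vertex_depth n (BottomSink i) = 2 * n + 1"

lemma arc_deeper: "(u, v) \<in> arcs (network n) \<Longrightarrow> vertex_depth n u < vertex_depth n v"
  unfolding arcs_network by (elim exE) (erule net_arc.cases, auto)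

lemma network_apath_iff_awalk: "pre_digraph.apath (network n) u p v \<longleftrightarrow> pre_digraph.awalk (network n) u p v"
proof -
  interpret fin_digraph "network n" by (rule fin_digraph_network)
  have "distinct (awalk_verts u p) \<and> (\<forall>x\<in>set (awalk_verts u p). vertex_depth n u \<le> vertex_depth n x)"
    if "awalk u p v"
    using that
  proof (induction p arbitrary: u)
    case Nil
    then show ?case by simp
  next
    case (Cons x p)
    then obtain w where w: "x = (u, w)" "(u, w) \<in> arcs (network n)" "awalk w p v"
      by (auto simp: network_awalk_Cons)
    then show ?case using Cons.IH[OF w(3)] arc_deeper[OF w(2)] by fastforce
  qed
  then show ?thesis by (auto simp: apath_def)
qed

section \<open>The right side of a path\<close>

lemma hop_faces:
  assumes m: "Suc m \<le> n" "1 \<le> e" "e \<le> Suc m" "e' = e \<or> e' = e - 1"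
    and U: "profile n (n - m) e' U"
    and uv: "(u, v) \<in> set (hop n m e e')" "net_arc n u v \<alpha> \<beta>"
  shows "\<alpha> \<in> line n (n - Suc m) e \<union> U \<and> n - Suc m \<le> fst \<alpha> \<and> n - Suc m \<le> fst \<beta>
    \<and> \<not> (fst \<alpha> = n - Suc m \<and> fst \<beta> = n - Suc m)"
proof -
  define a where "a = n - Suc m"
  have a: "n - m = Suc a" "n = a + Suc m" using m(1) by (auto simp: a_def)
  have u: "node n (Suc m) e = White a (Suc m - e) (e - 1)"
    using m by (auto simp: node_def a_def)
  have v: "node n m e' = (if e' = 0 then BottomSink (m + 1) else if e' = m + 1 then LeftSink (Suc a)
      else White (Suc a) (m - e') (e' - 1))"
    by (simp add: node_def a)
  from uv(2) show ?thesis
    using uv(1) m U unfolding hop_def u v unfolding a_def[symmetric] a(1) 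
    by (cases; simp add: profile_def line_def a(2) split: if_splits; linarith?)
qed

text \<open>The edge by which a path crosses a line is the only edge into its end that separates two faces
  on or beyond that line.\<close>

lemma hop_last_arc:
  assumes m: "Suc m \<le> n" "1 \<le> e" "e \<le> Suc m" "e' = e \<or> e' = e - 1"
    and arc: "net_arc n u (node n m e') \<alpha> \<beta>" "n - m \<le> fst \<alpha>" "n - m \<le> fst \<beta>"
  shows "(u, node n m e') \<in> set (hop n m e e')"
proof -
  define a where "a = n - Suc m"
  have a: "n - m = Suc a" "n = a + Suc m" using m(1) by (auto simp: a_def)
  define v where "v = node n m e'"
  have v: "v = (if e' = 0 then BottomSink (m + 1) else if e' = m + 1 then LeftSink (Suc a)
      else White (Suc a) (m - e') (e' - 1))"
    by (simp add: v_def node_def a)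
  from arc(1) have "net_arc n u v \<alpha> \<beta>" by (simp add: v_def)
  then show ?thesis
    unfolding v_def[symmetric] hop_def 
    using v arc(2,3) unfolding v_def[symmetric] a(1) a_def[symmetric]
    by (cases; simp add: a(2) split: if_splits)
qed

text \<open>The last conjunct keeps the line \<open>n - m\<close> connected above the crossing point: no later edge of the
  path separates two of its faces.\<close>

lemma routes_right_faces:
  assumes "m \<le> n" "x \<in> set (routes n m e r)" "(u, v) \<in> set (fst x)" "net_arc n u v \<alpha> \<beta>"
  shows "\<alpha> \<in> snd x \<and> n - m \<le> fst \<alpha> \<and> n - m \<le> fst \<beta> \<and> \<not> (fst \<alpha> = n - m \<and> fst \<beta> = n - m)"
  using assms
proof (induction m arbitrary: e x)
  case 0
  then show ?case by (auto simp: exit_routes_def split: if_splits)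
next
  case (Suc m)
  show ?case
  proof (cases "1 \<le> e \<and> e \<le> Suc m")
    case True
    then obtain e' y where y: "e' = e \<or> e' = e - 1" "y \<in> set (routes n m e' r)" "x = extend n m e e' y"
      using Suc.prems(2) by auto
    have "profile n (n - m) e' (snd y)"
      using routes_profile[OF _ y(2)] Suc.prems(1) by simp
    then have ?thesis if "(u, v) \<in> set (hop n m e e')"
      using hop_faces[OF Suc.prems(1) _ _ y(1) _ that Suc.prems(4), of "snd y"] True
      by (simp add: y(3) extend_def)
    moreover have ?thesis if "(u, v) \<in> set (fst y)"
      using Suc.IH[OF _ y(2) that Suc.prems(4)] Suc.prems(1) by (auto simp: y(3) extend_def)
    ultimately show ?thesis
      using Suc.prems(3) by (auto simp: y(3) extend_def)
  next
    case False
    then show ?thesis using Suc.prems by (auto simp: exit_routes_def split: if_splits)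
  qed
qed

text \<open>The region of a route is bounded by the route: an edge whose two sides are separated by the
  region lies on the route, or is the edge by which the route crossed its starting line.\<close>

lemma routes_separate:
  assumes "m \<le> n" "x \<in> set (routes n m e r)" "net_arc n u v \<alpha> \<beta>" "n - m \<le> fst \<alpha>" "n - m \<le> fst \<beta>"
    and "(u, v) \<notin> set (fst x)" "v \<noteq> node n m e"
  shows "\<alpha> \<in> snd x \<longleftrightarrow> \<beta> \<in> snd x"
  using assms
proof (induction m arbitrary: e x)
  have exit: "\<alpha> \<in> snd x \<longleftrightarrow> \<beta> \<in> snd x"
    if "x \<in> set (exit_routes n m e r)" "n - m \<le> fst \<alpha>" "n - m \<le> fst \<beta>" for x m e
    using that net_arc_faces[OF assms(3)] by (auto simp: exit_routes_def cells_def faces_def split: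
        if_splits)
  {
    case 0
    then show ?case using exit[of x 0 e] by simp
  next
    case (Suc m)
    show ?case
    proof (cases "1 \<le> e \<and> e \<le> Suc m")
      case False
      then show ?thesis using Suc.prems exit[of x "Suc m" e] by auto
    next
      case True
      then obtain e' y where y: "e' = e \<or> e' = e - 1" "y \<in> set (routes n m e' r)" "x = extend n m e e' y"
        using Suc.prems(2) by auto
      define a where "a = n - Suc m"
      have a: "n - m = Suc a" "n = a + Suc m" using Suc.prems(1) by (auto simp: a_def)
      have U: "snd y \<subseteq> cells n 0 (Suc a)" "profile n (Suc a) e' (snd y)"
        using routes_profile[OF _ y(2)] Suc.prems(1) by (auto simp: a(1))
      have x: "snd x = line n a e \<union> snd y" "fst x = hop n m e e' @ fst y"
        using y(3) by (simp_all add: extend_def a_def)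
      have u: "node n (Suc m) e = White a (Suc m - e) (e - 1)"
        using True by (auto simp: node_def a_def)
      have in_x: "(a, b, c) \<in> snd x \<longleftrightarrow> e \<le> c" if "a + b + c = n" for b c
        using that U by (auto simp: x line_def cells_def)
      have in_x': "(Suc a, b, c) \<in> snd x \<longleftrightarrow> e' \<le> c" if "Suc a + b + c = n" for b c
        using that U by (auto simp: x line_def profile_def)
      have deep: "\<alpha> \<in> snd x \<longleftrightarrow> \<beta> \<in> snd x" if "Suc a \<le> fst \<alpha>" "Suc a \<le> fst \<beta>"
      proof -
        have "v \<noteq> node n m e'"
          using hop_last_arc[OF Suc.prems(1) _ _ y(1), where u = u and \<alpha> = \<alpha> and \<beta> = \<beta>] True
              Suc.prems(3,6) that a(1) x(2) by auto
        then have "\<alpha> \<in> snd y \<longleftrightarrow> \<beta> \<in> snd y"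
          using Suc.IH[OF _ y(2)] Suc.prems that a(1) x(2) by simp
        then show ?thesis using that by (auto simp: x(1) line_def)
      qed
      have hop: "(u, v) \<notin> set (if e' = 0 then [(White a (Suc m - e) (e - 1), BottomSink (m + 1))]
          else if e' = m + 1 then [(White a (Suc m - e) (e - 1), LeftSink (a + 1))]
          else [(White a (Suc m - e) (e - 1), Black a (m - e') (e' - 1)),
                (Black a (m - e') (e' - 1), White (a + 1) (m - e') (e' - 1))])"
      proof -
        have "(u, v) \<notin> set (hop n m e e')" using Suc.prems(6) by (simp add: x(2))
        then show ?thesis unfolding hop_def u a_def[symmetric] by (simp add: node_def a(1) split: if_splits)
      qed
      show ?thesis
      proof (cases "Suc a \<le> fst \<alpha> \<and> Suc a \<le> fst \<beta>")
        case True
        then show ?thesis using deep by simp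
      next
        case False
        with Suc.prems(4,5) have lev: "fst \<alpha> = a \<or> fst \<beta> = a" "a \<le> fst \<alpha>" "a \<le> fst \<beta>"
          by (auto simp: a_def[symmetric])
        have e: "1 \<le> e" "e \<le> Suc m" using \<open>1 \<le> e \<and> e \<le> Suc m\<close> by auto
        note v = Suc.prems(7)[unfolded u]
        from Suc.prems(3) show ?thesis
        proof cases
          case (white_black_b a1 b1 c1)
          then have "a1 = a" using lev by auto
          then show ?thesis using white_black_b hop e y(1) in_x[of "b1 + 1" "c1 + 1"] in_x'[of "b1 +
              1" c1] a(2)
            by (auto split: if_splits)
        next
          case (white_black_c a1 b1 c1)
          then have "a1 = a" using lev by auto
          then show ?thesis using white_black_c hop e y(1) in_x'[of b1 "c1 + 1"] in_x[of "b1 + 1"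
              "c1 + 1"] a(2)
            by (auto split: if_splits)
        next
          case (black_white a1 b1 c1)
          then have "a1 + 1 = a" using lev by auto
          then show ?thesis using black_white v e in_x[of b1 "c1 + 1"] in_x[of "b1 + 1" c1] a(2)
            by auto
        next
          case (source i)
          then have "a = 0" using lev by auto
          then show ?thesis using source v e in_x[of "i - 1" "n - i + 1"] in_x[of i "n - i"] a(2)
            by auto
        next
          case (left_sink i)
          then have "i = a + 1" using lev by auto
          then show ?thesis using left_sink hop e y(1) in_x[of 0 "n - i + 1"] in_x'[of 0 "n - i"] a(2)
            by (auto split: if_splits)
        next
          case (bottom_sink i)
          then have "i = m + 1" using lev a(2) by auto
          then show ?thesis using bottom_sink hop e y(1) in_x'[of "i - 1" 0] in_x[of i 0] a(2)
            by (auto split: if_splits)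
        qed
      qed
    qed
  }
qed

text \<open>Adjacency of faces beyond the line \<open>n - m\<close> across an edge that is neither on the path nor the one
  by which the path crossed that line.\<close>

definition side_step :: "nat \<Rightarrow> nat \<Rightarrow> nat \<Rightarrow> (vertex \<times> vertex) awalk \<Rightarrow> (face \<times> face) set" where
  "side_step n m e p = {(\<alpha>, \<beta>). n - m \<le> fst \<alpha> \<and> n - m \<le> fst \<beta> \<and>
     (\<exists>u v. (net_arc n u v \<alpha> \<beta> \<or> net_arc n u v \<beta> \<alpha>) \<and> (u, v) \<notin> set p \<and> v \<noteq> node n m e)}"

lemma side_stepI:
  assumes "net_arc n u v \<alpha> \<beta> \<or> net_arc n u v \<beta> \<alpha>" "n - m \<le> fst \<alpha>" "n - m \<le> fst \<beta>"
    "(u, v) \<notin> set p" "v \<noteq> node n m e"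
  shows "(\<alpha>, \<beta>) \<in> side_step n m e p"
  unfolding side_step_def using assms by blast

lemma arc_into_white:
  assumes "a + b + c + 1 = n"
  obtains u where "net_arc n u (White a b c) (a, b, c + 1) (a, b + 1, c)"
proof (cases a)
  case 0
  then show ?thesis using that source[of "b + 1" n] assms by (simp add: eq_diff_iff) (metis
      add_diff_cancel_left' add_Suc_right add.commute)
next
  case (Suc a')
  then show ?thesis using that black_white[of a' b c n] assms by simp
qed

text \<open>Two consecutive faces of a line are separated by the edge into the white vertex between them.\<close>

lemma climb_line:
  assumes "n - m \<le> a" "e0 \<le> c" "a + b0 + e0 = n" "a + b + c = n"
    and avoid: "\<And>u b' c'. e0 \<le> c' \<Longrightarrow> net_arc n u (White a b' c') (a, b', c' + 1) (a, b' + 1, c')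
      \<Longrightarrow> (u, White a b' c') \<notin> set p \<and> White a b' c' \<noteq> node n m e"
  shows "((a, b0, e0), (a, b, c)) \<in> (side_step n m e p)\<^sup>*"
  using assms(2,4)
proof (induction c arbitrary: b rule: dec_induct)
  case base
  then have "b = b0" using assms(3) by simp
  then show ?case by simp
next
  case (step c)
  then have n: "a + b + c + 1 = n" by simp
  obtain u where u: "net_arc n u (White a b c) (a, b, c + 1) (a, b + 1, c)"
    using arc_into_white[OF n] .
  have "((a, b + 1, c), (a, b, Suc c)) \<in> side_step n m e p"
    using side_stepI[OF disjI2[OF u]] avoid[OF step.hyps(1) u] assms(1) by simp
  moreover have "((a, b0, e0), (a, b + 1, c)) \<in> (side_step n m e p)\<^sup>*"
    using step.IH[of "b + 1"] n by simp
  ultimately show ?case by (rule rtrancl_into_rtrancl[rotated])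
qed

text \<open>Every face of the region is reached from a face immediately to the right of the path: on each
  line that the path crosses, climb from the crossing point; beyond the last line, after an exit
  at the bottom, walk along the bottom side and climb from there.  For \<open>e \<le> m\<close> the face
  \<open>(n - m, m - e, e)\<close> is the one to the right of the edge into \<open>node n m e\<close>.\<close>

lemma routes_connected:
  assumes "m \<le> n" "x \<in> set (routes n m e r)" "\<alpha> \<in> snd x"
  shows "\<exists>\<sigma>. (\<sigma> = (n - m, m - e, e) \<or> (\<exists>u v \<beta>. (u, v) \<in> set (fst x) \<and> net_arc n u v \<sigma> \<beta>))
    \<and> (\<sigma>, \<alpha>) \<in> (side_step n m e (fst x))\<^sup>*"
  using assms
proof (induction m arbitrary: e x)
  have exit: "((n - m, m, 0), \<alpha>) \<in> (side_step n m 0 [])\<^sup>*"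
    if m: "m \<le> n" and \<alpha>: "\<alpha> \<in> cells n 0 (n - m)" for m \<alpha>
  proof -
    have bottom: "((n - m, m, 0), (a, n - a, 0)) \<in> (side_step n m 0 [])\<^sup>*" if "n - m \<le> a" "a \<le> n" for a
      using that
    proof (induction a rule: dec_induct)
      case base
      then show ?case using m by simp
    next
      case (step a)
      have "net_arc n (White (n - (n - a)) (n - a - 1) 0) (BottomSink (n - a)) (n - (n - a) + 1, n -
          a - 1, 0) (n - (n - a), n - a, 0)"
        using step.prems by (intro bottom_sink) auto
      then have "((a, n - a, 0), (Suc a, n - Suc a, 0)) \<in> side_step n m 0 []"
        using step by (intro side_stepI[of n "White (n - (n - a)) (n - a - 1) 0" "BottomSink (n -
            a)"]) (auto simp: node_def)
      then show ?case using step by (auto intro: rtrancl_into_rtrancl)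
    qed
    obtain a b c where abc: "\<alpha> = (a, b, c)" "a + b + c = n" "n - m \<le> a" using \<alpha> by (auto simp: cells_def)
    have "((a, n - a, 0), (a, b, c)) \<in> (side_step n m 0 [])\<^sup>*"
      using abc by (intro climb_line) (auto simp: node_def)
    then show ?thesis using bottom[of a] abc by (auto intro: rtrancl_trans)
  qed
  have exit': "\<exists>\<sigma>. (\<sigma> = (n - m, m - e, e) \<or> (\<exists>u v \<beta>. (u, v) \<in> set (fst x) \<and> net_arc n u v \<sigma> \<beta>))
    \<and> (\<sigma>, \<alpha>) \<in> (side_step n m e (fst x))\<^sup>*"
    if "m \<le> n" "x \<in> set (exit_routes n m e r)" "\<alpha> \<in> snd x" for m e x
    using that exit[of m \<alpha>] by (auto simp: exit_routes_def split: if_splits)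
  {
    case 0
    then show ?case using exit'[of 0 x e] by simp
  next
    case (Suc m)
    show ?case
    proof (cases "1 \<le> e \<and> e \<le> Suc m")
      case False
      then show ?thesis using Suc.prems exit'[of "Suc m" x e] by auto
    next
      case True
      then obtain e' y where y: "e' = e \<or> e' = e - 1" "y \<in> set (routes n m e' r)" "x = extend n m e e' y"
        using Suc.prems(2) by auto
      define a where "a = n - Suc m"
      have a: "n - m = Suc a" "n = a + Suc m" using Suc.prems(1) by (auto simp: a_def)
      have x: "snd x = line n a e \<union> snd y" "fst x = hop n m e e' @ fst y"
        using y(3) by (simp_all add: extend_def a_def)
      have u: "node n (Suc m) e = White a (Suc m - e) (e - 1)"
        using True by (auto simp: node_def a_def)
      have off: "\<not> (fst \<alpha> = a \<and> fst \<beta> = a)" if "(u, v) \<in> set (fst x)" "net_arc n u v \<alpha> \<beta>" for u v \<alpha> \<beta>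
        using routes_right_faces[OF Suc.prems(1,2) that] by (simp add: a_def)
      show ?thesis
      proof (cases "\<alpha> \<in> line n a e")
        case inline: True
        then obtain b c where \<alpha>: "\<alpha> = (a, b, c)" "a + b + c = n" "e \<le> c" by (auto simp: line_def)
        have "((a, Suc m - e, e), (a, b, c)) \<in> (side_step n (Suc m) e (fst x))\<^sup>*"
        proof (rule climb_line)
          show "(u, White a b' c') \<notin> set (fst x) \<and> White a b' c' \<noteq> node n (Suc m) e"
            if "e \<le> c'" "net_arc n u (White a b' c') (a, b', c' + 1) (a, b' + 1, c')" for u b' c'
            using off[of u "White a b' c'", OF _ that(2)] that(1) True unfolding u by auto
        qed (use \<alpha> True a(2) in auto)
        then show ?thesis by (auto simp: \<alpha>(1) a_def)
      next
        case False
        then have \<alpha>: "\<alpha> \<in> snd y" using Suc.prems(3) x by simp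
        then obtain \<sigma> where \<sigma>: "\<sigma> = (n - m, m - e', e') \<or> (\<exists>u v \<beta>. (u, v) \<in> set (fst y) \<and> net_arc n
            u v \<sigma> \<beta>)"
          "(\<sigma>, \<alpha>) \<in> (side_step n m e' (fst y))\<^sup>*"
          using Suc.IH[OF Suc_leD[OF Suc.prems(1)] y(2) \<alpha>] by blast
        have "side_step n m e' (fst y) \<subseteq> side_step n (Suc m) e (fst x)"
        proof
          fix z assume "z \<in> side_step n m e' (fst y)"
          then obtain \<kappa> \<mu> u' v' where z: "z = (\<kappa>, \<mu>)" "Suc a \<le> fst \<kappa>" "Suc a \<le> fst \<mu>"
            "net_arc n u' v' \<kappa> \<mu> \<or> net_arc n u' v' \<mu> \<kappa>" "(u', v') \<notin> set (fst y)" "v' \<noteq> node n m e'"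
            unfolding side_step_def a(1) by blast
          have "v' \<noteq> node n (Suc m) e"
            using z(2-4) unfolding u by (auto elim: net_arc.cases)
          moreover have "(u', v') \<notin> set (hop n m e e')"
          proof
            assume "(u', v') \<in> set (hop n m e e')"
            then have "u' = node n (Suc m) e \<and> (\<exists>i j. v' = Black a i j)"
              using z(6) by (auto simp: hop_def a_def split: if_splits)
            then show False using z(2-4) by (auto elim: net_arc.cases simp: u)
          qed
          ultimately show "z \<in> side_step n (Suc m) e (fst x)"
            unfolding z(1) using z x a by (intro side_stepI[OF z(4)]) auto
        qed
        then have "(\<sigma>, \<alpha>) \<in> (side_step n (Suc m) e (fst x))\<^sup>*"
          using \<sigma>(2) rtrancl_mono by blast
        moreover have "\<exists>u v \<beta>. (u, v) \<in> set (hop n m e e') \<and> net_arc n u v (n - m, m - e', e') \<beta>"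
        proof -
          have "e' \<noteq> m + 1" using \<alpha> y(2) by (auto simp: routes_left split: if_splits)
          then consider "e' = 0" | c where "e' = Suc c" "e' \<le> m" using True y(1) by (cases e') auto
          then show ?thesis
          proof cases
            case 1
            then have "e = 1" using y(1) True by auto
            have "net_arc n (White (n - (m+1)) (m + 1 - 1) 0) (BottomSink (m+1)) (n - (m+1) + 1, m +
                1 - 1, 0) (n - (m+1), m+1, 0)"
              using Suc.prems(1) by (intro bottom_sink) auto
            then show ?thesis using 1 \<open>e = 1\<close> a by (auto simp: hop_def node_def)
          next
            case 2
            have "net_arc n (Black a (m - e') c) (White (a + 1) (m - e') c) (a + 1, m - e', c + 1)
                (a + 1, m - e' + 1, c)"
              using a 2 by (intro black_white) auto
            then show ?thesis using 2 a
              by (intro exI[of _ "Black a (m - e') c"] exI[of _ "White (a + 1) (m - e') c"] exI[of _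
                  "(a + 1, m - e' + 1, c)"])
                (auto simp: hop_def node_def)
          qed
        qed
        then have "\<exists>u v \<beta>. (u, v) \<in> set (fst x) \<and> net_arc n u v \<sigma> \<beta>"
          using \<sigma>(1) unfolding x(2) set_append by blast
        ultimately show ?thesis by blast
      qed
    qed
  }
qed

lemma arc_from_source:
  assumes "net_arc n (Source j) v \<alpha> \<beta>"
  shows "v = White 0 (j - 1) (n - j) \<and> \<alpha> = (0, j - 1, n - j + 1)"
  using assms by cases auto

lemma source_node: "1 \<le> j \<Longrightarrow> j \<le> n \<Longrightarrow> node n n (n + 1 - j) = White 0 (j - 1) (n - j)"
  by (simp add: node_def)

text \<open>The region contains the faces immediately to the right of the path and is closed under
  adjacency off the path (\<open>routes_right_faces\<close>, \<open>routes_separate\<close>); conversely all of it is reached from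
  those faces (\<open>routes_connected\<close>).\<close>

lemma right_faces_route:
  assumes j: "1 \<le> j" "j \<le> n" and x: "x \<in> set (routes n n (n + 1 - j) r)"
  shows "right_faces n ((Source j, White 0 (j - 1) (n - j)) # fst x) = snd x"
proof -
  define P where "P = (Source j, White 0 (j - 1) (n - j)) # fst x"
  define R where "R = {(\<alpha>, \<beta>). \<exists>u v. (net_arc n u v \<alpha> \<beta> \<or> net_arc n u v \<beta> \<alpha>) \<and> (u, v) \<notin> set P}"
  have right: "right_faces n P = R\<^sup>* `` {\<alpha>. \<exists>u v \<beta>. (u, v) \<in> set P \<and> net_arc n u v \<alpha> \<beta>}"
    unfolding right_faces_def R_def ..
  let ?e = "n + 1 - j"
  have entry: "net_arc n (Source j) (White 0 (j - 1) (n - j)) (0, j - 1, n - j + 1) (0, j, n - j)"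
    using j by (rule source)
  have prof: "profile n 0 ?e (snd x)" using routes_profile[OF _ x] by simp
  have closed: "\<alpha> \<in> snd x \<longleftrightarrow> \<beta> \<in> snd x" if arc: "net_arc n u v \<alpha> \<beta>" "(u, v) \<notin> set P" for u v \<alpha> \<beta>
  proof (rule routes_separate[OF _ x arc(1)])
    show "v \<noteq> node n n ?e"
      using arc j unfolding source_node[OF j] P_def by (auto elim!: net_arc.cases)
  qed (use arc(2) in \<open>auto simp: P_def\<close>)
  show ?thesis
    unfolding P_def[symmetric] right
  proof (intro equalityI subsetI)
    fix \<alpha> assume "\<alpha> \<in> R\<^sup>* `` {\<alpha>. \<exists>u v \<beta>. (u, v) \<in> set P \<and> net_arc n u v \<alpha> \<beta>}"
    then obtain \<sigma> u v \<beta> where \<sigma>: "(\<sigma>, \<alpha>) \<in> R\<^sup>*" "(u, v) \<in> set P" "net_arc n u v \<sigma> \<beta>" by blast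
    have "\<sigma> \<in> snd x"
    proof (cases "(u, v) \<in> set (fst x)")
      case True
      then show ?thesis using routes_right_faces[OF _ x True \<sigma>(3)] by simp
    next
      case False
      then have "u = Source j" using \<sigma>(2) by (auto simp: P_def)
      then have "\<sigma> = (0, j - 1, n - j + 1)" using \<sigma>(3) arc_from_source by blast
      then show ?thesis using prof j by (simp add: profile_def)
    qed
    with \<sigma>(1) show "\<alpha> \<in> snd x"
    proof (induction rule: rtrancl_induct)
      case (step \<beta> \<gamma>)
      then obtain u v where "net_arc n u v \<beta> \<gamma> \<or> net_arc n u v \<gamma> \<beta>" "(u, v) \<notin> set P"
        unfolding R_def by blast
      then show ?case using closed step by blast
    qed
  next
    fix \<alpha> assume "\<alpha> \<in> snd x"
    then obtain \<sigma> where \<sigma>: "\<sigma> = (0, n - ?e, ?e) \<or> (\<exists>u v \<beta>. (u, v) \<in> set (fst x) \<and> net_arc n u v \<sigma> \<beta>)"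
      "(\<sigma>, \<alpha>) \<in> (side_step n n ?e (fst x))\<^sup>*"
      using routes_connected[OF le_refl x, unfolded diff_self_eq_0] by blast
    have "side_step n n ?e (fst x) \<subseteq> R"
      unfolding side_step_def R_def P_def source_node[OF j] by (simp, blast)
    then have "(\<sigma>, \<alpha>) \<in> R\<^sup>*" using \<sigma>(2) rtrancl_mono by blast
    moreover have "\<exists>u v \<beta>. (u, v) \<in> set P \<and> net_arc n u v \<sigma> \<beta>"
    proof -
      have "(0, n - ?e, ?e) = (0, j - 1, n - j + 1)" using j by auto
      then show ?thesis using \<sigma>(1) entry unfolding P_def by (metis list.set_intros)
    qed
    ultimately show "\<alpha> \<in> R\<^sup>* `` {\<alpha>. \<exists>u v \<beta>. (u, v) \<in> set P \<and> net_arc n u v \<alpha> \<beta>}" by blast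
  qed
qed

lemma net_matrix_routes:
  assumes j: "1 \<le> j" "j \<le> n" and r: "r \<in> {1..2*n}" and sink: "s i = sink n r"
  shows "net_matrix n s i j = (\<Sum>x\<leftarrow>routes n n (n + 1 - j) r. Zmon (face_vec (snd x)))"
proof -
  let ?e = "n + 1 - j"
  let ?f = "\<lambda>x. (Source j, White 0 (j - 1) (n - j)) # fst x"
  have arc: "(Source j, v) \<in> arcs (network n) \<longleftrightarrow> v = White 0 (j - 1) (n - j)" for v
    using arcs_networkI[OF source[OF j]] arc_from_source unfolding arcs_network by blast
  have ns: "sink n r \<noteq> Source j" by (simp add: sink_def)
  have "pre_digraph.apath (network n) (Source j) P (s i) \<longleftrightarrow> P \<in> ?f ` set (routes n n ?e r)" for P
  proof -
    have "pre_digraph.apath (network n) (Source j) P (s i)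
      \<longleftrightarrow> (\<exists>p. P = (Source j, White 0 (j - 1) (n - j)) # p \<and> pre_digraph.awalk (network n) (node n n
          ?e) p (sink n r))"
      unfolding network_apath_iff_awalk sink source_node[OF j] using ns
      by (cases P) (auto simp: network_awalk_Nil network_awalk_Cons arc)
    also have "\<dots> \<longleftrightarrow> P \<in> ?f ` set (routes n n ?e r)"
      using j r by (subst awalk_iff_route) auto
    finally show ?thesis .
  qed
  then have "net_matrix n s i j = (\<Sum>P\<in>set (map ?f (routes n n ?e r)). path_weight n P)"
    unfolding net_matrix_def by (intro sum.cong) auto
  also have "\<dots> = (\<Sum>P\<leftarrow>map ?f (routes n n ?e r). path_weight n P)"
  proof (rule sum_list_distinct_conv_sum_set[symmetric])
    have "map ?f (routes n n ?e r) = map ((#) (Source j, White 0 (j - 1) (n - j))) (map fst (routes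
        n n ?e r))"
      by simp
    then show "distinct (map ?f (routes n n ?e r))"
      using distinct_routes[of n n ?e r] by (simp add: distinct_map inj_on_def del: map_map)
  qed
  also have "\<dots> = (\<Sum>x\<leftarrow>routes n n ?e r. Zmon (face_vec (snd x)))"
  proof -
    have "path_weight n (?f x) = Zmon (face_vec (snd x))" if "x \<in> set (routes n n ?e r)" for x
      unfolding path_weight_def right_faces_route[OF j that] weyl_def face_vec_def ..
    then show ?thesis
      unfolding map_map comp_def by (intro arg_cong[where f = sum_list] map_cong refl)
  qed
  finally show ?thesis .
qed

section \<open>Pairing with the normalizing monomials\<close>

text \<open>The exponents of \<open>D\<^sub>1\<close> and \<open>D\<^sub>2\<close>.\<close>

definition height_vec :: "nat \<Rightarrow> qvec" where
  "height_vec n = (\<Sum>\<alpha>\<in>faces n. Poly_Mapping.single \<alpha> ((\<lambda>(a, b, c). of_nat c / of_nat n) \<alpha>))"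

definition depth_vec :: "nat \<Rightarrow> qvec" where
  "depth_vec n = (\<Sum>\<alpha>\<in>faces n. Poly_Mapping.single \<alpha> ((\<lambda>(a, b, c). of_nat a / of_nat n) \<alpha>))"

lemma lookup_face_sum:
  "\<alpha> \<in> faces n \<Longrightarrow> Poly_Mapping.lookup (\<Sum>\<alpha>\<in>faces n. Poly_Mapping.single \<alpha> (f \<alpha>)) \<alpha> = f \<alpha>"
  by (simp add: lookup_sum lookup_single when_def)

text \<open>A function that is linear in the coordinates has constant differences along the sides of the
  triangles, so the sum over a strip telescopes to its end at the bottom side, and the sum over
  the strips telescopes to corners.\<close>

lemma form_beyond_height:
  assumes "m \<le> n"
  shows "form_beyond n (n - m) \<kappa> (\<lambda>(a, b, c). of_nat c / of_nat n)
    = (\<kappa> (n, 0, 0) - \<kappa> (n - m, m, 0)) / (2 * of_nat n)"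
  using assms
proof (induction m)
  case 0
  have "cells n 1 n = {}" "cells n 2 n = {}" by (auto simp: cells_def)
  then show ?case by (simp add: form_beyond_def)
next
  case (Suc m)
  define a where "a = n - Suc m"
  have a: "n - m = Suc a" "a + Suc m = n" using Suc.prems by (auto simp: a_def)
  let ?\<mu> = "\<lambda>(a, b, c). of_nat c / of_nat n :: rat"
  define g where "g = (\<lambda>c. \<kappa> (a + 1, m - c, c) / (2 * of_nat n))"
  define h where "h = (\<lambda>c. \<kappa> (a, m - c + 1, c) / (2 * of_nat n))"
  have w: "white_form \<kappa> ?\<mu> (a, m - c, c) = g c - h c" for c
    by (simp add: triangle_form_def g_def h_def field_simps add_divide_distrib)
  have b: "black_form \<kappa> ?\<mu> (a, m - Suc c, c) = h (Suc c) - g (Suc c)" if "c < m" for c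
    using that by (simp add: triangle_form_def g_def h_def field_simps add_divide_distrib)
  have "(\<Sum>c\<le>m. white_form \<kappa> ?\<mu> (a, m - c, c)) + (\<Sum>c<m. black_form \<kappa> ?\<mu> (a, m - Suc c, c))
      = (\<Sum>c\<le>m. g c - h c) + (\<Sum>c<m. h (Suc c) - g (Suc c))"
    by (intro arg_cong2[where f = "(+)"] sum.cong refl w b) simp
  also have "(\<Sum>c\<le>m. g c - h c) = g 0 - h 0 + (\<Sum>c<m. g (Suc c) - h (Suc c))"
    by (simp only: lessThan_Suc_atMost[symmetric] sum.lessThan_Suc_shift)
  also have "\<dots> + (\<Sum>c<m. h (Suc c) - g (Suc c)) = g 0 - h 0"
    by (simp add: sum_subtractf)
  finally have strip: "(\<Sum>c\<le>m. white_form \<kappa> ?\<mu> (a, m - c, c))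
      + (\<Sum>c<m. black_form \<kappa> ?\<mu> (a, m - Suc c, c)) = g 0 - h 0" .
  show ?case
    using Suc.IH[OF Suc_leD[OF Suc.prems]]
    unfolding a_def[symmetric] a(1) form_beyond_step[OF a(2)] strip
    by (simp only: g_def h_def diff_divide_distrib) simp
qed

text \<open>The same telescoping; here each strip contributes at its bottom and at its left end.\<close>

lemma form_beyond_depth:
  assumes "m \<le> n"
  shows "form_beyond n (n - m) \<kappa> (\<lambda>(a, b, c). of_nat a / of_nat n)
    = (\<kappa> (n - m, m, 0) - \<kappa> (n - m, 0, m)) / (2 * of_nat n)"
  using assms
proof (induction m)
  case 0
  have "cells n 1 n = {}" "cells n 2 n = {}" by (auto simp: cells_def)
  then show ?case by (simp add: form_beyond_def)
next
  case (Suc m)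
  define a where "a = n - Suc m"
  have a: "n - m = Suc a" "a + Suc m = n" using Suc.prems by (auto simp: a_def)
  let ?\<mu> = "\<lambda>(a, b, c). of_nat a / of_nat n :: rat"
  define g where "g = (\<lambda>c. \<kappa> (a + 1, m - c, c) / (2 * of_nat n))"
  define h where "h = (\<lambda>c. \<kappa> (a, m + 1 - c, c) / (2 * of_nat n))"
  have w: "white_form \<kappa> ?\<mu> (a, m - c, c) = h c - h (Suc c)" if "c \<le> m" for c
    using that by (simp add: triangle_form_def h_def field_simps add_divide_distrib Suc_diff_le)
  have b: "black_form \<kappa> ?\<mu> (a, m - Suc c, c) = g (Suc c) - g c" if "c < m" for c
    using that by (simp add: triangle_form_def g_def field_simps add_divide_distrib Suc_diff_Suc)
  have "(\<Sum>c\<le>m. white_form \<kappa> ?\<mu> (a, m - c, c)) + (\<Sum>c<m. black_form \<kappa> ?\<mu> (a, m - Suc c, c))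
      = (\<Sum>c<Suc m. h c - h (Suc c)) + (\<Sum>c<m. g (Suc c) - g c)"
    unfolding lessThan_Suc_atMost
    by (intro arg_cong2[where f = "(+)"] sum.cong refl w b) simp_all
  also have "\<dots> = h 0 - h (Suc m) + (g m - g 0)"
    by (simp only: sum_lessThan_telescope sum_lessThan_telescope')
  finally have strip: "(\<Sum>c\<le>m. white_form \<kappa> ?\<mu> (a, m - c, c))
      + (\<Sum>c<m. black_form \<kappa> ?\<mu> (a, m - Suc c, c)) = h 0 - h (Suc m) + (g m - g 0)" .
  show ?case
    using Suc.IH[OF Suc_leD[OF Suc.prems]]
    unfolding a_def[symmetric] a(1) form_beyond_step[OF a(2)] strip
    by (simp only: g_def h_def diff_divide_distrib) simp
qed

lemma skew_form_height:
  "skew_form n \<kappa> (height_vec n)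
     = (Poly_Mapping.lookup \<kappa> (n, 0, 0) - Poly_Mapping.lookup \<kappa> (0, n, 0)) / (2 * of_nat n)"
proof -
  have "skew_form n \<kappa> (height_vec n)
      = form_beyond n 0 (Poly_Mapping.lookup \<kappa>) (\<lambda>(a, b, c). of_nat c / of_nat n)"
    unfolding skew_form_triangles height_vec_def
    by (rule form_beyond_cong) (simp_all add: lookup_face_sum flip: faces_cells)
  then show ?thesis using form_beyond_height[of n n] by simp
qed

lemma skew_form_depth:
  "skew_form n \<kappa> (depth_vec n)
     = (Poly_Mapping.lookup \<kappa> (0, n, 0) - Poly_Mapping.lookup \<kappa> (0, 0, n)) / (2 * of_nat n)"
proof -
  have "skew_form n \<kappa> (depth_vec n)
      = form_beyond n 0 (Poly_Mapping.lookup \<kappa>) (\<lambda>(a, b, c). of_nat a / of_nat n)"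
    unfolding skew_form_triangles depth_vec_def
    by (rule form_beyond_cong) (simp_all add: lookup_face_sum flip: faces_cells)
  then show ?thesis using form_beyond_depth[of n n] by simp
qed

lemma skew_form_add_left: "skew_form n (\<kappa> + \<kappa>') \<mu> = skew_form n \<kappa> \<mu> + skew_form n \<kappa>' \<mu>"
  by (simp add: skew_form_def lookup_add distrib_right sum.distrib)

lemma skew_form_diff_left: "skew_form n (\<kappa> - \<kappa>') \<mu> = skew_form n \<kappa> \<mu> - skew_form n \<kappa>' \<mu>"
  using skew_form_add_left[of n \<kappa> "- \<kappa>'" \<mu>] by (simp add: skew_form_uminus)

lemma skew_form_add_right: "skew_form n \<mu> (\<kappa> + \<kappa>') = skew_form n \<mu> \<kappa> + skew_form n \<mu> \<kappa>'"
  by (simp add: skew_form_def lookup_add distrib_left distrib_right sum.distrib)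

lemma skew_form_diff_right: "skew_form n \<mu> (\<kappa> - \<kappa>') = skew_form n \<mu> \<kappa> - skew_form n \<mu> \<kappa>'"
  using skew_form_add_right[of n \<mu> \<kappa> "- \<kappa>'"] by (simp add: skew_form_uminus)

lemma routes_left_corner:
  assumes "m \<le> n" "x \<in> set (routes n m e r)"
  shows "(n, 0, 0) \<in> snd x \<longleftrightarrow> n < r"
  using assms
proof (induction m arbitrary: e x)
  case 0
  then show ?case by (auto simp: exit_routes_def cells_def split: if_splits)
next
  case (Suc m)
  show ?case
  proof (cases "1 \<le> e \<and> e \<le> Suc m")
    case True
    then obtain e' y where y: "y \<in> set (routes n m e' r)" "x = extend n m e e' y"
      using Suc.prems(2) by auto
    then show ?thesis
      using Suc.IH[OF _ y(1)] Suc.prems(1) by (auto simp: extend_def line_def)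
  next
    case False
    then show ?thesis using Suc.prems by (auto simp: exit_routes_def cells_def split: if_splits)
  qed
qed

text \<open>The sources lie between the corner \<open>(0, 0, n)\<close> on the right of every path and the corner
  \<open>(0, n, 0)\<close> on its left; the third corner is on the right exactly of the paths to bottom sinks.\<close>

lemma route_corners:
  assumes "1 \<le> e" "e \<le> n" "x \<in> set (routes n n e r)"
  shows "Poly_Mapping.lookup (face_vec (snd x)) (n, 0, 0) = of_bool (n < r)"
    and "Poly_Mapping.lookup (face_vec (snd x)) (0, n, 0) = 0"
    and "Poly_Mapping.lookup (face_vec (snd x)) (0, 0, n) = 1"
proof -
  have "finite (snd x)"
    using routes_profile(1)[OF le_refl assms(3)] by (rule finite_subset) simp
  then show "Poly_Mapping.lookup (face_vec (snd x)) (n, 0, 0) = of_bool (n < r)"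
    "Poly_Mapping.lookup (face_vec (snd x)) (0, n, 0) = 0"
    "Poly_Mapping.lookup (face_vec (snd x)) (0, 0, n) = 1"
    using routes_left_corner[OF _ assms(3)] routes_profile(2)[OF _ assms(3)] assms(1,2)
    by (auto simp: lookup_face_vec profile_def)
qed

lemma skew_form_routes:
  assumes "x \<in> set (routes n n e r)" "y \<in> set (routes n n f r')"
  shows "skew_form n (face_vec (snd x)) (face_vec (snd y)) = form_beyond n 0 (ind (snd x)) (ind (snd y))"
proof -
  have "finite (snd x)" "finite (snd y)"
    using routes_profile(1)[OF le_refl assms(1)] routes_profile(1)[OF le_refl assms(2)]
    by (auto intro: finite_subset[OF _ finite_cells])
  then show ?thesis
    unfolding skew_form_triangles by (intro form_beyond_cong) (simp_all add: lookup_face_vec)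
qed

section \<open>Products in the quantum torus\<close>

lemma qt_mult_superset:
  assumes "finite A" "Poly_Mapping.keys f \<subseteq> A" "finite B" "Poly_Mapping.keys g \<subseteq> B"
  shows "qt_mult n qp f g = (\<Sum>\<kappa>\<in>A. \<Sum>\<mu>\<in>B. Poly_Mapping.single (\<kappa> + \<mu>)
          (qp (- skew_form n \<kappa> \<mu>) * (Poly_Mapping.lookup f \<kappa> * Poly_Mapping.lookup g \<mu>)))"
proof -
  have "qt_mult n qp f g = (\<Sum>\<kappa>\<in>Poly_Mapping.keys f. \<Sum>\<mu>\<in>B. Poly_Mapping.single (\<kappa> + \<mu>)
          (qp (- skew_form n \<kappa> \<mu>) * (Poly_Mapping.lookup f \<kappa> * Poly_Mapping.lookup g \<mu>)))"
    unfolding qt_mult_def using assms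
    by (intro sum.cong refl sum.mono_neutral_left) (auto simp: in_keys_iff)
  also have "\<dots> = (\<Sum>\<kappa>\<in>A. \<Sum>\<mu>\<in>B. Poly_Mapping.single (\<kappa> + \<mu>)
          (qp (- skew_form n \<kappa> \<mu>) * (Poly_Mapping.lookup f \<kappa> * Poly_Mapping.lookup g \<mu>)))"
    using assms by (intro sum.mono_neutral_left) (auto simp: in_keys_iff)
  finally show ?thesis .
qed

lemma qt_mult_add_left: "qt_mult n qp (f + f') g = qt_mult n qp f g + qt_mult n qp f' g"
proof -
  let ?A = "Poly_Mapping.keys f \<union> Poly_Mapping.keys f'"
  have "Poly_Mapping.keys (f + f') \<subseteq> ?A" by (rule keys_add)
  then show ?thesis
    by (subst (1 2 3) qt_mult_superset[where A = ?A and B = "Poly_Mapping.keys g"])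
       (auto simp: lookup_add distrib_left distrib_right single_add sum.distrib)
qed

lemma qt_mult_add_right: "qt_mult n qp g (f + f') = qt_mult n qp g f + qt_mult n qp g f'"
proof -
  let ?A = "Poly_Mapping.keys f \<union> Poly_Mapping.keys f'"
  have "Poly_Mapping.keys (f + f') \<subseteq> ?A" by (rule keys_add)
  then show ?thesis
    by (subst (1 2 3) qt_mult_superset[where B = ?A and A = "Poly_Mapping.keys g"])
       (auto simp: lookup_add distrib_left distrib_right single_add sum.distrib)
qed

lemma qt_mult_single:
  "qt_mult n qp (Poly_Mapping.single \<kappa> a) (Poly_Mapping.single \<mu> b)
     = Poly_Mapping.single (\<kappa> + \<mu>) (qp (- skew_form n \<kappa> \<mu>) * (a * b))"
  by (subst qt_mult_superset[where A = "{\<kappa>}" and B = "{\<mu>}"]) auto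

lemma qt_mult_zero: "qt_mult n qp 0 g = 0" "qt_mult n qp f 0 = 0"
  by (simp_all add: qt_mult_def)

lemma qt_mult_sum_list:
  "qt_mult n qp (\<Sum>x\<leftarrow>xs. F x) (\<Sum>y\<leftarrow>ys. G y) = (\<Sum>x\<leftarrow>xs. \<Sum>y\<leftarrow>ys. qt_mult n qp (F x) (G y))"
proof -
  have "qt_mult n qp f (\<Sum>y\<leftarrow>ys. G y) = (\<Sum>y\<leftarrow>ys. qt_mult n qp f (G y))" for f
    by (induction ys) (simp_all add: qt_mult_zero qt_mult_add_right)
  then show ?thesis
    by (induction xs) (simp_all add: qt_mult_zero qt_mult_add_left)
qed

lemma qt_scale_conv_mult: "qt_scale c f = Poly_Mapping.single 0 c * f"
  by (simp add: qt_scale_def mult_map_scale_conv_mult)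

section \<open>The transport matrices as path sums\<close>

text \<open>The \<open>i\<close>-th diagonal entry of \<open>Q\<close> times the only nonzero entry in the \<open>i\<close>-th row of \<open>S\<close>.\<close>

definition row_factor :: "(rat \<Rightarrow> 'k::field) \<Rightarrow> nat \<Rightarrow> nat \<Rightarrow> 'k" where
  "row_factor qp n i = qp (1 / 2 - of_nat i) * (- 1) ^ (n - i)"

lemma QS_mult:
  fixes qp :: "rat \<Rightarrow> 'k::field"
  assumes "i \<in> {1..n}"
  shows "scalar_mat_mult n (Q_mat qp) (scalar_mat_mult n (S_mat n) X) i j
     = qt_scale (row_factor qp n i) (X (n + 1 - i) j)"
proof -
  have z: "qt_scale 0 f = 0" for f :: "'k qtorus"
    by (simp add: qt_scale_conv_mult)
  have S: "scalar_mat_mult n (S_mat n) X i j = qt_scale ((- 1) ^ (n - i)) (X (n + 1 - i) j)"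
  proof -
    have "scalar_mat_mult n (S_mat n) X i j
      = (\<Sum>k=1..n. if k = n + 1 - i then qt_scale ((- 1) ^ (n - i)) (X k j) else 0)"
      unfolding scalar_mat_mult_def using assms
      by (intro sum.cong refl) (auto simp: S_mat_def z)
    moreover have "n + 1 - i \<in> {1..n}" using assms by auto
    ultimately show ?thesis by (simp only: sum.delta finite_atLeastAtMost if_True)
  qed
  have "scalar_mat_mult n (Q_mat qp) (scalar_mat_mult n (S_mat n) X) i j
    = (\<Sum>k=1..n. if k = i then qt_scale (qp (1 / 2 - of_nat i)) (scalar_mat_mult n (S_mat n) X k j) else 0)"
    unfolding scalar_mat_mult_def[of n "Q_mat qp"]
    by (intro sum.cong refl) (auto simp: Q_mat_def z)
  also have "\<dots> = qt_scale (qp (1 / 2 - of_nat i)) (scalar_mat_mult n (S_mat n) X i j)"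
    using assms by simp
  finally show ?thesis
    by (simp add: S qt_scale_conv_mult row_factor_def mult_single flip: mult.assoc)
qed

lemma scale_route_sum:
  "qt_scale c (\<Sum>x\<leftarrow>xs. Zmon (f x)) = (\<Sum>x\<leftarrow>xs. Poly_Mapping.single (f x) c)"
  by (simp add: qt_scale_conv_mult Zmon_def mult_single flip: sum_list_const_mult)

lemma route_sum_mult_Zmon:
  assumes "\<And>x. x \<in> set xs \<Longrightarrow> skew_form n (f x) \<delta> = s"
  shows "qt_mult n qp (\<Sum>x\<leftarrow>xs. Poly_Mapping.single (f x) c) (Zmon (- \<delta>))
    = (\<Sum>x\<leftarrow>xs. Poly_Mapping.single (f x - \<delta>) (c * qp s))"
proof -
  have "qt_mult n qp (\<Sum>x\<leftarrow>xs. Poly_Mapping.single (f x) c) (Zmon (- \<delta>))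
    = (\<Sum>x\<leftarrow>xs. qt_mult n qp (Poly_Mapping.single (f x) c) (Poly_Mapping.single (- \<delta>) 1))"
    using qt_mult_sum_list[where ys = "[()]" and G = "\<lambda>_. Zmon (- \<delta>)"] by (simp add: Zmon_def)
  also have "\<dots> = (\<Sum>x\<leftarrow>xs. Poly_Mapping.single (f x - \<delta>) (c * qp s))"
    using assms by (intro arg_cong[where f = sum_list] map_cong refl)
      (simp add: qt_mult_single skew_form_uminus mult.commute)
  finally show ?thesis .
qed

lemma skew_form_height_depth:
  assumes "0 < n"
  shows "skew_form n (height_vec n) (depth_vec n) = - 1 / (2 * of_nat n)"
proof -
  have "(0, n, 0) \<in> faces n" "(0, 0, n) \<in> faces n" by (simp_all add: faces_def)
  then show ?thesis using assms by (simp add: skew_form_depth height_vec_def lookup_face_sum)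
qed

definition route_sum :: "nat \<Rightarrow> nat \<Rightarrow> nat \<Rightarrow> qvec \<Rightarrow> 'k::field \<Rightarrow> 'k qtorus" where
  "route_sum n e r \<delta> c = (\<Sum>x\<leftarrow>routes n n e r. Poly_Mapping.single (face_vec (snd x) - \<delta>) c)"

text \<open>The monomial \<open>D\<^sub>1\<close> commutes with all weights of paths to left sinks, so no power of \<open>q\<close> appears.\<close>

lemma M1_route_sum:
  fixes qp :: "rat \<Rightarrow> 'k::field"
  assumes qp: "formal_rational_powers qp" and ij: "i \<in> {1..n}" "j \<in> {1..n}"
  shows "M1 n qp i j = route_sum n (n + 1 - j) (n + 1 - i) (height_vec n) (row_factor qp n i)"
proof -
  have e: "1 \<le> n + 1 - j" "n + 1 - j \<le> n" using ij by auto
  have "qp 0 = 1" using qp by (simp add: formal_rational_powers_def)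
  have D: "qt_inverse n qp (D1 n) = Zmon (- height_vec n)"
    unfolding D1_def weyl_def using qt_inverse_Zmon[OF qp] by (simp add: height_vec_def)
  have N: "net_matrix n LeftSink (n + 1 - i) j
      = (\<Sum>x\<leftarrow>routes n n (n + 1 - j) (n + 1 - i). Zmon (face_vec (snd x)) :: 'k qtorus)"
    using ij by (intro net_matrix_routes) (auto simp: sink_def)
  have "skew_form n (face_vec (snd x)) (height_vec n) = 0"
    if "x \<in> set (routes n n (n + 1 - j) (n + 1 - i))" for x
    using route_corners[OF e that] ij by (auto simp: skew_form_height)
  then show ?thesis
    unfolding M1_def QS_mult[OF ij(1)] N D scale_route_sum
    by (subst route_sum_mult_Zmon[where s = 0]) (auto simp: \<open>qp 0 = 1\<close> route_sum_def)
qed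

text \<open>The weights of paths to bottom sinks pair to \<open>1/(2n)\<close> and \<open>-1/(2n)\<close> with the exponents of \<open>D\<^sub>1\<close> and
  \<open>D\<^sub>2\<close>; what remains is the power of \<open>q\<close> from normally ordering \<open>D\<^sub>1\<^bsup>-1\<^esup> D\<^sub>2\<^bsup>-1\<^esup>\<close>.\<close>

lemma M2_route_sum:
  fixes qp :: "rat \<Rightarrow> 'k::field"
  assumes qp: "formal_rational_powers qp" and ij: "i \<in> {1..n}" "j \<in> {1..n}"
  shows "M2 n qp i j = route_sum n (n + 1 - j) (n + (n + 1 - i)) (height_vec n + depth_vec n)
    (row_factor qp n i * qp (1 / (2 * of_nat n)))"
proof -
  have e: "1 \<le> n + 1 - j" "n + 1 - j \<le> n" using ij by auto
  have q: "qp 0 = 1" using qp by (simp add: formal_rational_powers_def)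
  have D1: "qt_inverse n qp (D1 n) = Zmon (- height_vec n)"
    unfolding D1_def weyl_def using qt_inverse_Zmon[OF qp] by (simp add: height_vec_def)
  have D2: "qt_inverse n qp (D2 n) = Zmon (- depth_vec n)"
    unfolding D2_def weyl_def using qt_inverse_Zmon[OF qp] by (simp add: depth_vec_def)
  have N: "net_matrix n BottomSink (n + 1 - i) j
      = (\<Sum>x\<leftarrow>routes n n (n + 1 - j) (n + (n + 1 - i)). Zmon (face_vec (snd x)) :: 'k qtorus)"
    using ij by (intro net_matrix_routes) (auto simp: sink_def)
  have 1: "skew_form n (face_vec (snd x)) (height_vec n) = 1 / (2 * of_nat n)"
    and 2: "skew_form n (face_vec (snd x) - height_vec n) (depth_vec n) = 0"
    if "x \<in> set (routes n n (n + 1 - j) (n + (n + 1 - i)))" for x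
    using route_corners[OF e that] ij
    by (simp_all add: skew_form_height skew_form_depth[of n "face_vec (snd x)"] skew_form_diff_left
        skew_form_height_depth)
  show ?thesis
    unfolding M2_def QS_mult[OF ij(1)] N D1 D2 scale_route_sum
    by (subst route_sum_mult_Zmon[OF 1], assumption, subst route_sum_mult_Zmon[OF 2], assumption)
       (simp add: q route_sum_def diff_diff_add)
qed

section \<open>The \<open>R\<close>-matrix relations\<close>

context q_powers
begin

lemma qt_mult_route_sums:
  assumes s: "\<And>x y. x \<in> set (routes n n e r) \<Longrightarrow> y \<in> set (routes n n f r') \<Longrightarrow>
      skew_form n (face_vec (snd x) - \<delta>) (face_vec (snd y) - \<delta>')
        = skew_form n (face_vec (snd x)) (face_vec (snd y)) + s"
  shows "qt_mult n qp (\<Sum>x\<leftarrow>routes n n e r. Poly_Mapping.single (face_vec (snd x) - \<delta>) c)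
      (\<Sum>y\<leftarrow>routes n n f r'. Poly_Mapping.single (face_vec (snd y) - \<delta>') c')
    = Poly_Mapping.single (- \<delta> - \<delta>') (c * c') * (q_pow (- s) * pair_sum n qp (- 1) n e f r r')"
proof -
  have "qt_mult n qp (\<Sum>x\<leftarrow>routes n n e r. Poly_Mapping.single (face_vec (snd x) - \<delta>) c)
      (\<Sum>y\<leftarrow>routes n n f r'. Poly_Mapping.single (face_vec (snd y) - \<delta>') c')
    = (\<Sum>x\<leftarrow>routes n n e r. \<Sum>y\<leftarrow>routes n n f r'.
        Poly_Mapping.single (- \<delta> - \<delta>') (c * c') * (q_pow (- s) * pair_term n qp (- 1) 0 (snd x) (snd y)))"
    unfolding qt_mult_sum_list
  proof (intro arg_cong[where f = sum_list] map_cong refl)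
    fix x y assume xy: "x \<in> set (routes n n e r)" "y \<in> set (routes n n f r')"
    have e: "face_vec (snd x) - \<delta> + (face_vec (snd y) - \<delta>') = - \<delta> - \<delta>' + (face_vec (snd x) +
        face_vec (snd y))"
      by (simp add: algebra_simps)
    have k: "- (form_beyond n 0 (ind (snd x)) (ind (snd y)) + s) = - s + - 1 * form_beyond n 0 (ind
        (snd x)) (ind (snd y))"
      by simp
    show "qt_mult n qp (Poly_Mapping.single (face_vec (snd x) - \<delta>) c) (Poly_Mapping.single (face_vec
        (snd y) - \<delta>') c')
      = Poly_Mapping.single (- \<delta> - \<delta>') (c * c') * (q_pow (- s) * pair_term n qp (- 1) 0 (snd x) (snd y))"
      unfolding qt_mult_single s[OF xy] skew_form_routes[OF xy] pair_term_def q_pow_def mult_single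
          e k qp_add
      by (simp add: ac_simps)
  qed
  also have "\<dots> = Poly_Mapping.single (- \<delta> - \<delta>') (c * c') * (q_pow (- s) * pair_sum n qp (- 1) n e f r r')"
    by (simp add: pair_sum_def sum_list_const_mult)
  finally show ?thesis .
qed

text \<open>The \<open>R\<close>-matrix has at most two nonzero entries in each column.\<close>

lemma sum_R_mat:
  assumes "i \<in> {1..n}" "k \<in> {1..n}"
  shows "(\<Sum>z\<in>{1..n} \<times> {1..n}. qt_scale (R_mat n qp z (i, k)) (F z))
    = q_pow (- (1 / of_nat n)) * (q_pow (of_bool (i = k)) * F (i, k)
        + of_bool (i < k) * (q_pow 1 - q_pow (- 1)) * F (k, i))"
proof -
  let ?q = "qp (- (1 / of_nat n))"
  have R: "R_mat n qp (p, p') (i, k)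
     = (if (p, p') = (i, k) then ?q * qp (of_bool (i = k)) else 0)
       + (if (p, p') = (k, i) then ?q * of_bool (i < k) * (qp 1 - qp (- 1)) else 0)"
    if "p \<in> {1..n}" "p' \<in> {1..n}" for p p'
  proof -
    have A: "(\<Sum>a=1..n. \<Sum>b=1..n. kron (matrix_unit a a) (matrix_unit b b) (p, p') (i, k)) = (of_bool
        (p = i \<and> p' = k) :: 'k)"
    proof -
      have "(\<Sum>a=1..n. \<Sum>b=1..n. kron (matrix_unit a a) (matrix_unit b b) (p, p') (i, k))
         = (\<Sum>a=1..n. \<Sum>b=1..n. if b = p' then (if a = p then of_bool (p = i \<and> p' = k) else 0) else 0 :: 'k)"
        by (intro sum.cong refl) (auto simp: kron_def matrix_unit_def)
      then show ?thesis using that by simp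
    qed
    have B: "(\<Sum>a=1..n. kron (matrix_unit a a) (matrix_unit a a) (p, p') (i, k)) = (of_bool (p = i \<and>
        p' = k \<and> i = k) :: 'k)"
    proof -
      have "(\<Sum>a=1..n. kron (matrix_unit a a) (matrix_unit a a) (p, p') (i, k))
         = (\<Sum>a=1..n. if a = p then of_bool (p = i \<and> p' = k \<and> i = k) else 0 :: 'k)"
        by (intro sum.cong refl) (auto simp: kron_def matrix_unit_def)
      then show ?thesis using that by simp
    qed
    have C: "(\<Sum>(a, b)\<in>{(a, b). a \<in> {1..n} \<and> b \<in> {1..n} \<and> a > b}.
         kron (matrix_unit a b) (matrix_unit b a) (p, p') (i, k)) = (of_bool (p = k \<and> p' = i \<and> i <
             k) :: 'k)"
    proof -
      have fin: "finite {(a, b). a \<in> {1..n} \<and> b \<in> {1..n} \<and> a > b}"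
        by (rule finite_subset[of _ "{1..n} \<times> {1..n}"]) auto
      have "(\<Sum>(a, b)\<in>{(a, b). a \<in> {1..n} \<and> b \<in> {1..n} \<and> a > b}.
         kron (matrix_unit a b) (matrix_unit b a) (p, p') (i, k))
        = (\<Sum>z\<in>{(a, b). a \<in> {1..n} \<and> b \<in> {1..n} \<and> a > b}. if z = (p, p') then of_bool (p = k \<and> p' =
            i) else 0 :: 'k)"
        by (intro sum.cong refl) (auto simp: kron_def matrix_unit_def split: if_splits)
      then show ?thesis using that fin by auto
    qed
    show ?thesis
      unfolding R_mat_def A B C by (cases i k rule: linorder_cases) (auto simp: qp_0)
  qed
  have fin: "finite ({1..n} \<times> {1..n})" by simp
  have "(\<Sum>z\<in>{1..n} \<times> {1..n}. qt_scale (R_mat n qp z (i, k)) (F z))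
     = (\<Sum>z\<in>{1..n} \<times> {1..n}.
        (if z = (i, k) then Poly_Mapping.single 0 (?q * qp (of_bool (i = k))) * F z else 0)
        + (if z = (k, i) then Poly_Mapping.single 0 (?q * of_bool (i < k) * (qp 1 - qp (- 1))) * F z
            else 0))"
  proof (intro sum.cong refl)
    fix z assume z: "z \<in> {1..n} \<times> {1..n}"
    have Rz: "R_mat n qp z (i, k) = (if z = (i, k) then ?q * qp (of_bool (i = k)) else 0)
       + (if z = (k, i) then ?q * of_bool (i < k) * (qp 1 - qp (- 1)) else 0)"
      using z R[of "fst z" "snd z"] by (simp add: mem_Times_iff)
    show "qt_scale (R_mat n qp z (i, k)) (F z)
      = (if z = (i, k) then Poly_Mapping.single 0 (?q * qp (of_bool (i = k))) * F z else 0)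
        + (if z = (k, i) then Poly_Mapping.single 0 (?q * of_bool (i < k) * (qp 1 - qp (- 1))) * F z
            else 0)"
      unfolding Rz qt_scale_conv_mult single_add distrib_right
      by (intro arg_cong2[where f = "(+)"]) (auto simp only: single_zero mult_zero_left split: if_split)
  qed
  also have "\<dots> = Poly_Mapping.single 0 (?q * qp (of_bool (i = k))) * F (i, k)
      + Poly_Mapping.single 0 (?q * of_bool (i < k) * (qp 1 - qp (- 1))) * F (k, i)"
    unfolding sum.distrib using assms by (simp only: sum.delta[OF fin]) simp
  also have "\<dots> = q_pow (- (1 / of_nat n)) * (q_pow (of_bool (i = k)) * F (i, k) + of_bool (i < k) *
      (q_pow 1 - q_pow (- 1)) * F (k, i))"
    by (simp add: q_pow_def distrib_left mult_single flip: single_diff mult.assoc)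
  finally show ?thesis .
qed

text \<open>The shift by the exponents of the normalizing monomials changes the form by a constant,
  because it depends only on the corners.\<close>

lemma route_sum_mult:
  assumes e: "e \<in> {1..n}" and f: "f \<in> {1..n}"
    and s: "\<And>\<kappa> \<mu>. Poly_Mapping.lookup \<kappa> (n, 0, 0) = of_bool (n < r) \<Longrightarrow>
      Poly_Mapping.lookup \<kappa> (0, n, 0) = 0 \<Longrightarrow> Poly_Mapping.lookup \<kappa> (0, 0, n) = 1 \<Longrightarrow>
      Poly_Mapping.lookup \<mu> (n, 0, 0) = of_bool (n < r') \<Longrightarrow>
      Poly_Mapping.lookup \<mu> (0, n, 0) = 0 \<Longrightarrow> Poly_Mapping.lookup \<mu> (0, 0, n) = 1 \<Longrightarrow>
      skew_form n (\<kappa> - \<delta>) (\<mu> - \<delta>') = skew_form n \<kappa> \<mu> + s"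
  shows "qt_mult n qp (route_sum n e r \<delta> c) (route_sum n f r' \<delta>' c')
    = Poly_Mapping.single (- \<delta> - \<delta>') (c * c') * (q_pow (- s) * pair_sum n qp (- 1) n e f r r')"
  unfolding route_sum_def
proof (rule qt_mult_route_sums)
  fix x y assume x: "x \<in> set (routes n n e r)" and y: "y \<in> set (routes n n f r')"
  show "skew_form n (face_vec (snd x) - \<delta>) (face_vec (snd y) - \<delta>')
      = skew_form n (face_vec (snd x)) (face_vec (snd y)) + s"
    using route_corners[OF _ _ x] route_corners[OF _ _ y] e f by (intro s) auto
qed

text \<open>Sink numbers are decreasing in the row index because \<open>S\<close> reverses the order of the rows, and
  states are decreasing in the column index.\<close>

lemma RTT_relation:
  assumes ij: "i \<in> {1..n}" "k \<in> {1..n}" "j \<in> {1..n}" "l \<in> {1..n}"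
    and M: "\<And>i j. i \<in> {1..n} \<Longrightarrow> j \<in> {1..n} \<Longrightarrow> M i j = route_sum n (n + 1 - j) (\<rho> i) \<delta> (c i)"
    and prod: "\<And>i j k l. i \<in> {1..n} \<Longrightarrow> j \<in> {1..n} \<Longrightarrow> k \<in> {1..n} \<Longrightarrow> l \<in> {1..n} \<Longrightarrow>
      qt_mult n qp (route_sum n (n + 1 - j) (\<rho> i) \<delta> (c i)) (route_sum n (n + 1 - l) (\<rho> k) \<delta> (c k))
      = Poly_Mapping.single (- \<delta> - \<delta>) (c i * c k) * pair_sum n qp (- 1) n (n + 1 - j) (n + 1 - l) (\<rho>
          i) (\<rho> k)"
    and \<rho>: "\<And>i k. i \<in> {1..n} \<Longrightarrow> k \<in> {1..n} \<Longrightarrow> \<rho> i < \<rho> k \<longleftrightarrow> k < i"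
  shows "scalar_left n (total_transpose (R_mat n qp)) (tensor12 n qp M M) (i, k) (j, l)
       = scalar_right n (tensor21 n qp M M) (R_mat n qp) (i, k) (j, l)"
proof -
  have inj: "\<rho> i = \<rho> k \<longleftrightarrow> i = k"
    using \<rho>[OF ij(1,2)] \<rho>[OF ij(2,1)] by (cases i k rule: linorder_cases) auto
  have jl: "n + 1 - j = n + 1 - l \<longleftrightarrow> j = l" "n + 1 - l < n + 1 - j \<longleftrightarrow> j < l"
    using ij by auto
  define W where "W = Poly_Mapping.single (- \<delta> - \<delta>) (c i * c k)"
  define P where "P = pair_sum n qp (- 1) n"
  define e f r r' where "e = n + 1 - j" and "f = n + 1 - l" and "r = \<rho> i" and "r' = \<rho> k"
  note defs = W_def P_def e_def f_def r_def r'_def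
  have p: "qt_mult n qp (M i j) (M k l) = W * P e f r r'" "qt_mult n qp (M k l) (M i j) = W * P f e r' r"
    "qt_mult n qp (M k j) (M i l) = W * P e f r' r"
    using ij by (simp_all only: M prod defs mult.commute[of "c k" "c i"])
  have "scalar_left n (total_transpose (R_mat n qp)) (tensor12 n qp M M) (i, k) (j, l)
    = q_pow (- (1 / of_nat n)) * (q_pow (of_bool (i = k)) * (W * P e f r r') + of_bool (i < k) *
        (q_pow 1 - q_pow (- 1)) * (W * P e f r' r))"
    unfolding scalar_left_def total_transpose_def sum_R_mat[OF ij(1,2)] by (simp add: tensor12_def p)
  also have "\<dots> = q_pow (- (1 / of_nat n)) * (W * (q_pow (of_bool (r = r')) * P e f r r' + of_bool
      (r' < r) * (q_pow 1 - q_pow (- 1)) * P e f r' r))"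
    unfolding r_def r'_def inj \<rho>[OF ij(2,1)] by (simp add: algebra_simps)
  also have "q_pow (of_bool (r = r')) * P e f r r' + of_bool (r' < r) * (q_pow 1 - q_pow (- 1)) * P e f r' r
    = q_pow (of_bool (e = f)) * P f e r' r + of_bool (f < e) * (q_pow 1 - q_pow (- 1)) * P e f r' r"
    unfolding P_def by (rule pair_sum_RTT) simp
  also have "q_pow (- (1 / of_nat n)) * (W * \<dots>)
    = q_pow (- (1 / of_nat n)) * (q_pow (of_bool (j = l)) * (W * P f e r' r) + of_bool (j < l) *
        (q_pow 1 - q_pow (- 1)) * (W * P e f r' r))"
    unfolding e_def f_def jl by (simp add: algebra_simps)
  also have "\<dots> = scalar_right n (tensor21 n qp M M) (R_mat n qp) (i, k) (j, l)"
    unfolding scalar_right_def sum_R_mat[OF ij(3,4)] by (simp add: tensor21_def p)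
  finally show ?thesis .
qed

end

theorem theorem2p5:
  fixes n :: nat and qp :: "rat \<Rightarrow> 'k::field"
  assumes "n \<ge> 2"
    and "formal_rational_powers qp"
  shows "\<forall>x \<in> {1..n} \<times> {1..n}. \<forall>y \<in> {1..n} \<times> {1..n}.
      (\<forall>M \<in> {M1 n qp, M2 n qp}.
         scalar_left n (total_transpose (R_mat n qp)) (tensor12 n qp M M) x y
           = scalar_right n (tensor21 n qp M M) (R_mat n qp) x y)
      \<and> tensor12 n qp (M1 n qp) (M2 n qp) x y
           = scalar_right n (tensor21 n qp (M2 n qp) (M1 n qp)) (R_mat n qp) x y"
proof (intro ballI)
  fix x y assume xy: "x \<in> {1..n} \<times> {1..n}" "y \<in> {1..n} \<times> {1..n}"
  obtain i k where x: "x = (i, k)" and ik: "i \<in> {1..n}" "k \<in> {1..n}" using xy(1) by auto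
  obtain j l where y: "y = (j, l)" and jl: "j \<in> {1..n}" "l \<in> {1..n}" using xy(2) by auto
  interpret q_powers qp
    using assms(2) by unfold_locales (auto simp: formal_rational_powers_def)
  have n: "0 < n" using assms(1) by simp
  let ?h = "height_vec n" and ?d = "depth_vec n"
  let ?t = "1 / (2 * of_nat n) :: rat"
  let ?u = "qp ?t"
  have flip: "skew_form n ?h \<mu> = - skew_form n \<mu> ?h" "skew_form n ?d \<mu> = - skew_form n \<mu> ?d" for \<mu>
    by (rule skew_form_antisym)+
  note expand = skew_form_diff_left skew_form_diff_right skew_form_add_left skew_form_add_right
  have hd: "skew_form n ?h ?d = - ?t" using skew_form_height_depth[OF n] by simp
  have e: "n + 1 - j \<in> {1..n}" if "j \<in> {1..n}" for j using that by auto
  have "scalar_left n (total_transpose (R_mat n qp)) (tensor12 n qp (M1 n qp) (M1 n qp)) x y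
      = scalar_right n (tensor21 n qp (M1 n qp) (M1 n qp)) (R_mat n qp) x y"
    unfolding x y
  proof (rule RTT_relation[OF ik jl M1_route_sum[OF assms(2)]])
    fix i j k l assume a: "i \<in> {1..n}" "j \<in> {1..n}" "k \<in> {1..n}" "l \<in> {1..n}"
    show "qt_mult n qp (route_sum n (n + 1 - j) (n + 1 - i) ?h (row_factor qp n i))
        (route_sum n (n + 1 - l) (n + 1 - k) ?h (row_factor qp n k))
      = Poly_Mapping.single (- ?h - ?h) (row_factor qp n i * row_factor qp n k)
        * pair_sum n qp (- 1) n (n + 1 - j) (n + 1 - l) (n + 1 - i) (n + 1 - k)"
      using a
    proof (subst route_sum_mult[OF e e, where s = 0])
      fix \<kappa> \<mu> :: qvec assume "Poly_Mapping.lookup \<kappa> (n, 0, 0) = of_bool (n < n + 1 - i)"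
        "Poly_Mapping.lookup \<kappa> (0, n, 0) = 0" "Poly_Mapping.lookup \<mu> (n, 0, 0) = of_bool (n < n + 1 - k)"
        "Poly_Mapping.lookup \<mu> (0, n, 0) = 0"
      then have "skew_form n \<kappa> ?h = 0" "skew_form n \<mu> ?h = 0"
        using a unfolding skew_form_height by auto
      then show "skew_form n (\<kappa> - ?h) (\<mu> - ?h) = skew_form n \<kappa> \<mu> + 0"
        unfolding expand flip(1)[of \<mu>] by simp
    qed auto
  qed auto
  moreover have "scalar_left n (total_transpose (R_mat n qp)) (tensor12 n qp (M2 n qp) (M2 n qp)) x y
      = scalar_right n (tensor21 n qp (M2 n qp) (M2 n qp)) (R_mat n qp) x y"
    unfolding x y
  proof (rule RTT_relation[OF ik jl M2_route_sum[OF assms(2)]])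
    fix i j k l assume a: "i \<in> {1..n}" "j \<in> {1..n}" "k \<in> {1..n}" "l \<in> {1..n}"
    show "qt_mult n qp (route_sum n (n + 1 - j) (n + (n + 1 - i)) (?h + ?d) (row_factor qp n i * ?u))
        (route_sum n (n + 1 - l) (n + (n + 1 - k)) (?h + ?d) (row_factor qp n k * ?u))
      = Poly_Mapping.single (- (?h + ?d) - (?h + ?d)) (row_factor qp n i * ?u * (row_factor qp n k * ?u))
        * pair_sum n qp (- 1) n (n + 1 - j) (n + 1 - l) (n + (n + 1 - i)) (n + (n + 1 - k))"
      using a
    proof (subst route_sum_mult[OF e e, where s = 0])
      fix \<kappa> \<mu> :: qvec assume "Poly_Mapping.lookup \<kappa> (n, 0, 0) = of_bool (n < n + (n + 1 - i))"
        "Poly_Mapping.lookup \<kappa> (0, n, 0) = 0" "Poly_Mapping.lookup \<kappa> (0, 0, n) = 1"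
        "Poly_Mapping.lookup \<mu> (n, 0, 0) = of_bool (n < n + (n + 1 - k))"
        "Poly_Mapping.lookup \<mu> (0, n, 0) = 0" "Poly_Mapping.lookup \<mu> (0, 0, n) = 1"
      then have "skew_form n \<kappa> ?h = ?t" "skew_form n \<kappa> ?d = - ?t" "skew_form n \<mu> ?h = ?t" "skew_form
          n \<mu> ?d = - ?t"
        using a unfolding skew_form_height skew_form_depth by auto
      then show "skew_form n (\<kappa> - (?h + ?d)) (\<mu> - (?h + ?d)) = skew_form n \<kappa> \<mu> + 0"
        unfolding expand flip(1)[of \<mu>] flip(2)[of \<mu>] flip(2)[of ?h] by simp
    qed auto
  qed auto
  moreover have "tensor12 n qp (M1 n qp) (M2 n qp) x y
           = scalar_right n (tensor21 n qp (M2 n qp) (M1 n qp)) (R_mat n qp) x y"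
  proof -
    \<comment> \<open>The three normalizing terms leave \<open>1/(2n)\<close>, and \<open>-1/(2n)\<close> in the opposite order; the ratio
      of the two powers of \<open>q\<close> is the prefactor of the \<open>R\<close>-matrix.\<close>
    have form: "skew_form n (\<kappa> - ?h) (\<mu> - (?h + ?d)) = skew_form n \<kappa> \<mu> + ?t"
      if "Poly_Mapping.lookup \<kappa> (n, 0, 0) = 0" "Poly_Mapping.lookup \<kappa> (0, n, 0) = 0"
          "Poly_Mapping.lookup \<kappa> (0, 0, n) = 1"
        "Poly_Mapping.lookup \<mu> (n, 0, 0) = 1" "Poly_Mapping.lookup \<mu> (0, n, 0) = 0" for \<kappa> \<mu>
    proof -
      have "skew_form n \<kappa> ?h = 0" "skew_form n \<kappa> ?d = - ?t" "skew_form n \<mu> ?h = ?t"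
        using that unfolding skew_form_height skew_form_depth by auto
      then show ?thesis
        unfolding expand flip(1)[of \<mu>] hd by simp
    qed
    have form': "skew_form n (\<mu> - (?h + ?d)) (\<kappa> - ?h) = skew_form n \<mu> \<kappa> + - ?t"
      if "Poly_Mapping.lookup \<kappa> (n, 0, 0) = 0" "Poly_Mapping.lookup \<kappa> (0, n, 0) = 0"
          "Poly_Mapping.lookup \<kappa> (0, 0, n) = 1"
        "Poly_Mapping.lookup \<mu> (n, 0, 0) = 1" "Poly_Mapping.lookup \<mu> (0, n, 0) = 0" for \<kappa> \<mu>
      using form[OF that] skew_form_antisym[of n "\<kappa> - ?h" "\<mu> - (?h + ?d)"] skew_form_antisym[of n \<kappa>
          \<mu>] by simp
    define r r' where "r = n + 1 - i" and "r' = n + (n + 1 - k)"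
    have rr: "r < r'" using ik by (auto simp: r_def r'_def)
    define ci ck where "ci = row_factor qp n i" and "ck = row_factor qp n k * ?u"
    define W where "W = Poly_Mapping.single (- ?h - (?h + ?d)) (ci * ck)"
    define P where "P = (\<lambda>\<epsilon> j l. pair_sum n qp \<epsilon> n (n + 1 - j) (n + 1 - l) r r')"
    have 12: "qt_mult n qp (M1 n qp i j) (M2 n qp k l) = W * (q_pow (- ?t) * P (- 1) j l)"
      if "j \<in> {1..n}" "l \<in> {1..n}" for j l
      unfolding M1_route_sum[OF assms(2) ik(1) that(1)] M2_route_sum[OF assms(2) ik(2) that(2)]
        W_def P_def r_def r'_def ci_def ck_def using ik that
      by (intro route_sum_mult[OF e e] form) auto
    have 21: "qt_mult n qp (M2 n qp k l) (M1 n qp i j) = W * (q_pow ?t * P 1 j l)"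
      if "j \<in> {1..n}" "l \<in> {1..n}" for j l
    proof -
      have "qt_mult n qp (M2 n qp k l) (M1 n qp i j)
        = Poly_Mapping.single (- (?h + ?d) - ?h) (ck * ci) * (q_pow (- (- ?t)) * pair_sum n qp (- 1)
            n (n + 1 - l) (n + 1 - j) r' r)"
        unfolding M1_route_sum[OF assms(2) ik(1) that(1)] M2_route_sum[OF assms(2) ik(2) that(2)]
          r_def r'_def ci_def ck_def using ik that
        by (intro route_sum_mult[OF e e] form') auto
      moreover have "- (?h + ?d) - ?h = - ?h - (?h + ?d)" by simp
      ultimately show ?thesis
        by (simp only: W_def P_def pair_sum_swap[of n qp 1] mult.commute[of ck ci] minus_minus)
    qed
    have lt: "n + 1 - l < n + 1 - j \<longleftrightarrow> j < l" "n + 1 - j = n + 1 - l \<longleftrightarrow> j = l" using jl by auto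
    have PP: "P (- 1) j l = q_pow (of_bool (j = l)) * P 1 j l + of_bool (j < l) * (q_pow 1 - q_pow
        (- 1)) * P 1 l j"
      using pair_sum_exchange[where n = n and m = n and e = "n + 1 - j" and f = "n + 1 - l", OF
          le_refl rr] unfolding P_def lt .
    have QQ: "q_pow (- ?t) = q_pow (- (1 / of_nat n)) * q_pow ?t"
      unfolding q_pow_add[symmetric] using n by (intro arg_cong[where f = q_pow]) (simp add: field_simps)
    have "scalar_right n (tensor21 n qp (M2 n qp) (M1 n qp)) (R_mat n qp) x y
      = q_pow (- (1 / of_nat n)) * (q_pow (of_bool (j = l)) * (W * (q_pow ?t * P 1 j l))
          + of_bool (j < l) * (q_pow 1 - q_pow (- 1)) * (W * (q_pow ?t * P 1 l j)))"
      unfolding x y scalar_right_def sum_R_mat[OF jl]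
      by (simp only: tensor21_def case_prod_conv 21[OF jl] 21[OF jl(2,1)])
    also have "\<dots> = W * (q_pow (- ?t) * P (- 1) j l)"
      unfolding PP QQ by (simp add: algebra_simps)
    also have "\<dots> = tensor12 n qp (M1 n qp) (M2 n qp) x y"
      unfolding x y by (simp only: tensor12_def case_prod_conv 12[OF jl])
    finally show ?thesis by simp
  qed
  ultimately show "(\<forall>M \<in> {M1 n qp, M2 n qp}.
         scalar_left n (total_transpose (R_mat n qp)) (tensor12 n qp M M) x y
           = scalar_right n (tensor21 n qp M M) (R_mat n qp) x y)
      \<and> tensor12 n qp (M1 n qp) (M2 n qp) x y
           = scalar_right n (tensor21 n qp (M2 n qp) (M1 n qp)) (R_mat n qp) x y"
    by blast
qed

end
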